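(* Let $K$ be a field of characteristic $0$, let $C$ be an elliptic curve over $K$ with $K$-rational point $\infty$, and let $X=C\setminus\{\infty\}$ with affine model $y^2=f(x)$, $f\in K[x]$, $\deg f=3$. Let $\alpha_0,\alpha_1$ be regular $1$-forms on $X$, $\alpha_0$ regular on $C$ and $\alpha_1$ with a pole of order $2$ at $\infty$, whose classes form a $K$-basis of $H^1_{dR}(X/K)$. For $n\ge 0$ let $\mathcal{U}_n=(R_n\otimes\mathcal{O}_X,\nabla)$ and let $C_n$ be the connection matrix of $\mathcal{U}_n$ with respect to the ordered basis $\mathcal{B}_n$ (notation in the context). Then there is an open $Y\subset C$ containing $\infty$ such that for all $n\ge 1$ there is an isomorphism $G_n$ (a gauge transformation, given by an invertible matrix of functions) of $\mathcal{U}_n$ with a logarithmic connection $\mathcal{U}'_n=(R_n\otimes\mathcal{O}_Y,\,d+C'_n)$ with logarithmic poles at $\infty$, over $X\cap Y$, i.e. $C'_n=G_n^{-1}dG_n+G_n^{-1}C_nG_n$, which is compatible with projection to lower level. The isomorphism $G_n$ can be chosen such that \[ G_n=\begin{pmatrix} I_{2^n} & H_n\\ 0 & G_{n-1}\end{pmatrix}\quad(G_0=(1)), \] where $H_n$ is a $2^n\times(2^n-1)$ matrix of functions on $C$ and $C'_n$ is a matrix of $1$-forms on $C$, such that, with the block decompositions described in the context: (A) for all $r,i$ there are rational functions $h^{r,i}_n\in K(C)$ with $H^{r,i}_n=h^{r,i}_nI_{2^i}$; (B) for all $0\le i\le n$: (B1) for all $r=1,\dots,2^{n+1-i}-2$ there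 are $1$-forms $c^{r,i}_n$ on $X$ with at worst logarithmic poles at $\infty$ such that $C^{r,i}_n=c^{r,i}_nI_{2^i}$; (B2) $C^{2^{n+1-i}-1,i}_n=0_{2^i\times 2^i}$; (B3) $C^{2^{n+1-i},i}_n=0_{(2^i-1)\times 2^i}$.
   Context: $V_{dr}=H^1_{dR}(X/K)^\vee$ has basis $A_0,A_1$ dual to $\alpha_0,\alpha_1$. $R_n$ is the tensor algebra of $V_{dr}$ modulo the two-sided ideal spanned by words in $A_0,A_1$ of length $\ge n+1$; $\mathcal{U}_n=R_n\otimes\mathcal{O}_X$ with the connection $\nabla(s)=ds-\sum_{i=0}^1 A_i s\otimes\alpha_i$ (here $d$ acts on coefficients and $A_is$ is left multiplication). The ordered basis $\mathcal{B}_n$ of $R_n$ consists of the words of length $\le n$ in graded lexicographic order: first the $2^n$ words of length $n$, then those of length $n-1$, \dots, finally the empty word $1$; within a fixed length words are ordered lexicographically with $A_0<A_1$ and the leftmost letter most significant. Write $w^k_l$ for the $k$-th word of length $l$ (so $A_0w^k_l=w^k_{l+1}$, $A_1w^k_l=w^{k+2^l}_{l+1}$). The connection matrix $\Omega$ of a connection with respect to a basis $(e_j)$ is defined by $\nabla(e_j)=\sum_i e_i\otimes\Omega_{ij}$, so $\nabla$ acts as $d+\Omega$ on coefficient column vectors; for an invertible matrix of functions $G$, the gauge transformation is $\Omega\mapsto G^{-1}dG+G^{-1}\Omega G$. A logarithmic connection on $Y$ with log poles at $\infty$ means the entries of the connection matrix are $1$-forms regular on $Y\setminus\{\infty\}$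 with at worst simple poles at $\infty$. Block decompositions: the columns of $H_n$ are split, from left to right, into blocks indexed by $i=n-1,\dots,0$, block $i$ having $2^i$ columns (corresponding to the words of length $i$); within column block $i$ the $2^n$ rows are split into $2^{n-i}$ consecutive blocks of $2^i$ rows, indexed $r=1,\dots,2^{n-i}$ from the top; $H^{r,i}_n$ is the resulting $2^i\times2^i$ block. The columns of the $(2^{n+1}-1)\times(2^{n+1}-1)$ matrix $C'_n$ are split, from left to right, into blocks indexed by $i=n,\dots,0$ of width $2^i$; within column block $i$ the rows are split into consecutive blocks indexed $r=1,\dots,2^{n+1-i}$ from the top, the first $2^{n+1-i}-1$ of height $2^i$ and the last of height $2^i-1$; $C^{r,i}_n$ denotes these blocks.
   Formalization: In (B1) the forms c are regular on X∩Y with at most a simple pole at ∞, not on all of X: for n=1, c=dh−α_1 regular on X with a log pole at ∞ would need a function h whose only pole is a simple one at ∞, impossible in genus 1. *)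

theory Defs
  imports
    "HOL-Computational_Algebra.Polynomial"
    "HOL-Algebra.Ideal"
    "Jordan_Normal_Form.Matrix"
begin

section \<open>The curve, its function field and its differentials\<close>

text \<open>
  The function field \<open>K(C)\<close> is modelled by an arbitrary field type \<open>'f\<close> together with a
  \<open>K\<close>-algebra structure \<open>cst\<close> and the coordinate functions \<open>xf\<close>, \<open>yf\<close>; the space of rational
  1-forms \<open>\<Omega>(K(C)/K)\<close> by an arbitrary type \<open>'w\<close> with scalar multiplication \<open>smul\<close> and universal
  derivation \<open>dif\<close>. \<open>weierstrass_model\<close> and \<open>kaehler_differentials\<close> below determine these data
  up to unique isomorphism.
\<close>

record (overloaded) ('k, 'f, 'w) curve =
  cst :: "'k \<Rightarrow> 'f"
  wpoly :: "'k poly"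
  xf :: 'f
  yf :: 'f
  smul :: "'f \<Rightarrow> 'w \<Rightarrow> 'w"
  dif :: "'f \<Rightarrow> 'w"

definition alg_gen :: "('k::field_char_0, 'f::field, 'w) curve \<Rightarrow> 'f \<Rightarrow> 'f \<Rightarrow> 'f set" where
  \<comment> \<open>the subalgebra \<open>K[u, v]\<close> of \<open>K(C)\<close>: all values of bivariate polynomials\<close>
  "alg_gen C u v =
     range (\<lambda>p :: 'k poly poly. poly (map_poly (\<lambda>q. poly (map_poly (cst C) q) u) p) v)"

abbreviation affine_ring :: "('k::field_char_0, 'f::field, 'w) curve \<Rightarrow> 'f set" where
  "affine_ring C \<equiv> alg_gen C (xf C) (yf C)"

text \<open>
  In characteristic 0 the Jacobian criterion says that \<open>y\<^sup>2 = f(x)\<close> is smooth iff \<open>f\<close> and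
  \<open>f'\<close> are coprime. As \<open>f\<close> has odd degree, it is not a square in \<open>K(x)\<close>, so the last three
  conditions identify \<open>'f\<close> with the fraction field of \<open>K[x, y]/(y\<^sup>2 - f(x))\<close>.
\<close>

definition weierstrass_model :: "('k::field_char_0, 'f::field, 'w) curve \<Rightarrow> bool" where
  "weierstrass_model C \<longleftrightarrow>
     cst C 1 = 1 \<and>
     (\<forall>a b. cst C (a + b) = cst C a + cst C b) \<and>
     (\<forall>a b. cst C (a * b) = cst C a * cst C b) \<and>
     degree (wpoly C) = 3 \<and>
     coprime (wpoly C) (pderiv (wpoly C)) \<and>
     (\<forall>p. poly (map_poly (cst C) p) (xf C) = 0 \<longrightarrow> p = 0) \<and>
     (yf C)\<^sup>2 = poly (map_poly (cst C) (wpoly C)) (xf C) \<and>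
     (\<forall>g. \<exists>a\<in>affine_ring C. \<exists>b\<in>affine_ring C. b \<noteq> 0 \<and> g = a / b)"

definition derivation_into ::
  "('k \<Rightarrow> 'f::field) \<Rightarrow> ('f \<Rightarrow> 'v::ab_group_add \<Rightarrow> 'v) \<Rightarrow> ('f \<Rightarrow> 'v) \<Rightarrow> bool" where
  "derivation_into c s D \<longleftrightarrow>
     (\<forall>a. D (c a) = 0) \<and>
     (\<forall>g h. D (g + h) = D g + D h) \<and>
     (\<forall>g h. D (g * h) = s g (D h) + s h (D g))"

text \<open>
  Universality is only demanded for derivations with values in \<open>K(C)\<close>. Since \<open>K(C)\<close> is a field,
  linear functionals separate the vectors of any vector space, so together with the spanning
  condition (which gives uniqueness) this is the full universal property.
\<close>

definition kaehler_differentials :: "('k, 'f::field, 'w::ab_group_add) curve \<Rightarrow> bool" where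
  "kaehler_differentials C \<longleftrightarrow>
     vector_space (smul C) \<and>
     derivation_into (cst C) (smul C) (dif C) \<and>
     module.span (smul C) (range (dif C)) = UNIV \<and>
     (\<forall>D :: 'f \<Rightarrow> 'f. derivation_into (cst C) (*) D \<longrightarrow>
        (\<exists>\<phi>. Vector_Spaces.linear (smul C) (*) \<phi> \<and> (\<forall>g. \<phi> (dif C g) = D g)))"

definition elliptic_curve :: "('k::field_char_0, 'f::field, 'w::ab_group_add) curve \<Rightarrow> bool" where
  "elliptic_curve C \<longleftrightarrow> weierstrass_model C \<and> kaehler_differentials C"


section \<open>Points, regularity and poles\<close>

text \<open>
  Closed points (of arbitrary degree over \<open>K\<close>): those of the affine part \<open>X\<close> are the maximal
  ideals of \<open>K[x, y]\<close>; \<open>\<infinity> = [0 : 1 : 0]\<close> is the origin of the chart of the projective closure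
  with coordinates \<open>x/y\<close>, \<open>1/y\<close>.
\<close>

datatype 'f point = Infinity | Affine "'f set"

definition ring_on :: "'f::field set \<Rightarrow> 'f ring" where
  "ring_on A = \<lparr>carrier = A, monoid.mult = (*), one = 1, ring.zero = 0, add = (+)\<rparr>"

definition affine_points :: "('k::field_char_0, 'f::field, 'w) curve \<Rightarrow> 'f point set" where
  "affine_points C = Affine ` {M. maximalideal M (ring_on (affine_ring C))}"

definition points :: "('k::field_char_0, 'f::field, 'w) curve \<Rightarrow> 'f point set" where
  "points C = insert Infinity (affine_points C)"

definition localization :: "'f::field set \<Rightarrow> 'f set \<Rightarrow> 'f set" where
  "localization A M = {a / b | a b. a \<in> A \<and> b \<in> A \<and> b \<notin> M}"

abbreviation infinity_chart :: "('k::field_char_0, 'f::field, 'w) curve \<Rightarrow> 'f set" where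
  "infinity_chart C \<equiv> alg_gen C (xf C / yf C) (1 / yf C)"

definition infinity_ideal :: "('k::field_char_0, 'f::field, 'w) curve \<Rightarrow> 'f set" where
  "infinity_ideal C =
     {xf C / yf C * a + 1 / yf C * b | a b. a \<in> infinity_chart C \<and> b \<in> infinity_chart C}"

fun local_ring :: "('k::field_char_0, 'f::field, 'w) curve \<Rightarrow> 'f point \<Rightarrow> 'f set" where
  "local_ring C Infinity = localization (infinity_chart C) (infinity_ideal C)"
| "local_ring C (Affine M) = localization (affine_ring C) M"

definition zariski_open :: "('k::field_char_0, 'f::field, 'w) curve \<Rightarrow> 'f point set \<Rightarrow> bool" where
  \<comment> \<open>the proper closed subsets of a curve are the finite sets of closed points\<close>
  "zariski_open C Y \<longleftrightarrow> Y \<subseteq> points C \<and> (Y = {} \<or> finite (points C - Y))"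

definition regular_fun_on ::
  "('k::field_char_0, 'f::field, 'w) curve \<Rightarrow> 'f point set \<Rightarrow> 'f \<Rightarrow> bool" where
  "regular_fun_on C U g \<longleftrightarrow> (\<forall>P\<in>U. g \<in> local_ring C P)"

definition local_forms ::
  "('k::field_char_0, 'f::field, 'w::ab_group_add) curve \<Rightarrow> 'f point \<Rightarrow> 'w set" where
  \<comment> \<open>the stalk at \<open>P\<close> of the sheaf of differentials: the \<open>\<O>\<^sub>P\<close>-span of \<open>d \<O>\<^sub>P\<close>\<close>
  "local_forms C P =
     {(\<Sum>i<m. smul C (a i) (dif C (b i))) | (m::nat) a b.
        \<forall>i<m. a i \<in> local_ring C P \<and> b i \<in> local_ring C P}"

definition regular_form_on ::
  "('k::field_char_0, 'f::field, 'w::ab_group_add) curve \<Rightarrow> 'f point set \<Rightarrow> 'w \<Rightarrow> bool" where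
  "regular_form_on C U \<omega> \<longleftrightarrow> (\<forall>P\<in>U. \<omega> \<in> local_forms C P)"

definition pole_order_le ::
  "('k::field_char_0, 'f::field, 'w::ab_group_add) curve \<Rightarrow> nat \<Rightarrow> 'w \<Rightarrow> bool" where
  \<comment> \<open>pole at \<open>\<infinity>\<close> of order at most \<open>m\<close>; \<open>x/y\<close> is a uniformizer at \<open>\<infinity>\<close>\<close>
  "pole_order_le C m \<omega> \<longleftrightarrow> smul C ((xf C / yf C) ^ m) \<omega> \<in> local_forms C Infinity"

definition log_form_on ::
  "('k::field_char_0, 'f::field, 'w::ab_group_add) curve \<Rightarrow> 'f point set \<Rightarrow> 'w \<Rightarrow> bool" where
  "log_form_on C Y \<omega> \<longleftrightarrow> regular_form_on C (Y - {Infinity}) \<omega> \<and> pole_order_le C 1 \<omega>"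

text \<open>
  As \<open>X\<close> is affine, \<open>H\<^sup>1\<^sub>d\<^sub>R(X/K)\<close> is the quotient of the regular 1-forms on \<open>X\<close> by the
  differentials of the regular functions on \<open>X\<close>.
\<close>

definition de_rham_basis ::
  "('k::field_char_0, 'f::field, 'w::ab_group_add) curve \<Rightarrow> 'w \<Rightarrow> 'w \<Rightarrow> bool" where
  "de_rham_basis C \<alpha>0 \<alpha>1 \<longleftrightarrow>
     regular_form_on C (affine_points C) \<alpha>0 \<and>
     regular_form_on C (affine_points C) \<alpha>1 \<and>
     (\<forall>\<omega>. regular_form_on C (affine_points C) \<omega> \<longrightarrow>
        (\<exists>!(a, b). \<omega> - (smul C (cst C a) \<alpha>0 + smul C (cst C b) \<alpha>1)
                     \<in> dif C ` {g. regular_fun_on C (affine_points C) g}))"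


section \<open>The connections \<open>\<U>\<^sub>n\<close>\<close>

text \<open>
  \<open>R\<^sub>n\<close> has the words of length at most \<open>n\<close> as basis; an element of \<open>R\<^sub>n \<otimes> M\<close> is given by its
  coefficient function \<open>letter list \<Rightarrow> M\<close>, supported on these words.
\<close>

datatype letter = A0 | A1

fun words :: "nat \<Rightarrow> letter list list" where
  "words 0 = [[]]"
| "words (Suc l) = map ((#) A0) (words l) @ map ((#) A1) (words l)"

fun word_basis :: "nat \<Rightarrow> letter list list" where
  "word_basis 0 = words 0"
| "word_basis (Suc n) = words (Suc n) @ word_basis n"

definition left_mult ::
  "nat \<Rightarrow> letter \<Rightarrow> (letter list \<Rightarrow> 'f::zero) \<Rightarrow> letter list \<Rightarrow> 'f" where
  \<comment> \<open>\<open>A s\<close> in \<open>R\<^sub>n \<otimes> M\<close>: words of length \<open>n + 1\<close> vanish\<close>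
  "left_mult n A s w =
     (case w of [] \<Rightarrow> 0 | B # v \<Rightarrow> if B = A \<and> length w \<le> n then s v else 0)"

definition nabla ::
  "('k, 'f::field, 'w::ab_group_add) curve \<Rightarrow> 'w \<Rightarrow> 'w \<Rightarrow> nat
     \<Rightarrow> (letter list \<Rightarrow> 'f) \<Rightarrow> letter list \<Rightarrow> 'w" where
  "nabla C \<alpha>0 \<alpha>1 n s =
     (\<lambda>w. dif C (s w) - (smul C (left_mult n A0 s w) \<alpha>0 + smul C (left_mult n A1 s w) \<alpha>1))"

definition connection_matrix ::
  "nat \<Rightarrow> ((letter list \<Rightarrow> 'f::field) \<Rightarrow> letter list \<Rightarrow> 'w) \<Rightarrow> 'w mat" where
  \<comment> \<open>column \<open>j\<close> holds the coefficients of the connection applied to the \<open>j\<close>-th basis word\<close>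
  "connection_matrix n D =
     mat (length (word_basis n)) (length (word_basis n))
       (\<lambda>(i, j). D (\<lambda>w. if w = word_basis n ! j then 1 else 0) (word_basis n ! i))"

definition projection_matrix :: "nat \<Rightarrow> 'f::field mat" where
  \<comment> \<open>the projection from \<open>R\<^sub>n\<^sub>+\<^sub>1\<close> to \<open>R\<^sub>n\<close>\<close>
  "projection_matrix n =
     mat (length (word_basis n)) (length (word_basis (Suc n)))
       (\<lambda>(i, j). if word_basis n ! i = word_basis (Suc n) ! j then 1 else 0)"


section \<open>Gauge transformations and blocks\<close>

definition fun_form_mult ::
  "('k, 'f, 'w::ab_group_add) curve \<Rightarrow> 'f mat \<Rightarrow> 'w mat \<Rightarrow> 'w mat" where
  "fun_form_mult C M W =
     mat (dim_row M) (dim_col W) (\<lambda>(i, j). \<Sum>k<dim_col M. smul C (M $$ (i, k)) (W $$ (k, j)))"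

definition form_fun_mult ::
  "('k, 'f, 'w::ab_group_add) curve \<Rightarrow> 'w mat \<Rightarrow> 'f mat \<Rightarrow> 'w mat" where
  "form_fun_mult C W M =
     mat (dim_row W) (dim_col M) (\<lambda>(i, j). \<Sum>k<dim_col W. smul C (M $$ (k, j)) (W $$ (i, k)))"

definition gauge_transforms ::
  "('k::field_char_0, 'f::field, 'w::ab_group_add) curve \<Rightarrow> 'f point set
     \<Rightarrow> 'f mat \<Rightarrow> 'w mat \<Rightarrow> 'w mat \<Rightarrow> bool" where
  \<comment> \<open>\<open>G\<close> is invertible over \<open>\<O>(U)\<close> and transforms \<open>\<Omega>\<close> into \<open>\<Omega>'\<close>\<close>
  "gauge_transforms C U G \<Omega> \<Omega>' \<longleftrightarrow>
     G \<in> carrier_mat (dim_row \<Omega>) (dim_row \<Omega>) \<and>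
     (\<forall>g\<in>elements_mat G. regular_fun_on C U g) \<and>
     (\<exists>G' \<in> carrier_mat (dim_row \<Omega>) (dim_row \<Omega>).
        (\<forall>g\<in>elements_mat G'. regular_fun_on C U g) \<and>
        inverts_mat G G' \<and> inverts_mat G' G \<and>
        \<Omega>' = fun_form_mult C G' (map_mat (dif C) G) +
              form_fun_mult C (fun_form_mult C G' \<Omega>) G)"

definition block :: "'a mat \<Rightarrow> nat \<Rightarrow> nat \<Rightarrow> nat \<Rightarrow> nat \<Rightarrow> 'a mat" where
  "block M r0 c0 height width = mat height width (\<lambda>(a, b). M $$ (r0 + a, c0 + b))"

text \<open>In both cases \<open>r\<close> counts from 1 and the column blocks are indexed in decreasing order.\<close>

definition H_block :: "nat \<Rightarrow> 'a mat \<Rightarrow> nat \<Rightarrow> nat \<Rightarrow> 'a mat" where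
  "H_block n H r i = block H ((r - 1) * 2 ^ i) (\<Sum>j\<in>{i<..<n}. 2 ^ j) (2 ^ i) (2 ^ i)"

definition C_block :: "nat \<Rightarrow> 'a mat \<Rightarrow> nat \<Rightarrow> nat \<Rightarrow> 'a mat" where
  "C_block n M r i =
     block M ((r - 1) * 2 ^ i) (\<Sum>j\<in>{i<..n}. 2 ^ j)
       (if r = 2 ^ (n + 1 - i) then 2 ^ i - 1 else 2 ^ i) (2 ^ i)"

definition scalar_form_mat :: "nat \<Rightarrow> 'w::zero \<Rightarrow> 'w mat" where
  "scalar_form_mat m c = mat m m (\<lambda>(a, b). if a = b then c else 0)"

end

(*
  R_n with coefficients in K(C) is a truncation of the noncommutative power series in A_0, A_1, and
  the connection is d minus left multiplication by A = A_0 alpha_0 + A_1 alpha_1. Gauging by left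
  multiplication with a series g with constant term 1 gives left multiplication by
  c = g^(-1) dg - g^(-1) A g, which has constant term 0. In the graded lexicographic basis, left
  multiplication by a series is a matrix whose blocks are the coefficients times identity matrices;
  this gives the block shapes and the compatibility with projections for free.

  It remains to choose g so that all coefficients of c are logarithmic. The coefficient of c at a
  word w is d g_w plus an expression in the g_v for shorter words v, so g is found recursively once
  every form is, up to an exact form, logarithmic at infinity. With t = x/y, local forms at infinity
  lie in K dt + t * (local forms), so the pole order m >= 2 of a form is lowered by subtracting a
  multiple of d(t^(1-m)). The coefficients of g are polynomials in y/x, so Y only has
  to avoid the finitely many points of X where x vanishes.
*)

theory Submission
  imports Defs "Jordan_Normal_Form.Determinant"
begin

section \<open>Words and noncommutative power series\<close>

text \<open>The block shapes rest on binary indices: within a fixed length the index of a word is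
  the word read as a binary number, so dividing an index by \<open>2 ^ i\<close> separates the word
  into a prefix and a suffix of length \<open>i\<close>. The rows of a full block of height
  \<open>2 ^ i\<close> share their prefix, the columns of block \<open>i\<close> are the possible
  suffixes, and the block is the coefficient at the prefix times an identity matrix. The block in
  (B2) belongs to the empty prefix, where the constant term 0 of c appears; the short last row block
  in (B3) consists of words of length below \<open>i\<close>, which cannot end in a word of length
  \<open>i\<close>. The series are defined on all words and not only on those of length at most n.
  One choice of g therefore serves every level, and no gauge has to be lifted from level n - 1 to
  level n. The lowering of pole orders has to stop at order 1, since dt/t is not a constant multiple
  of the differential of a power of t; above that it divides by m - 1, which is where characteristic
  0 enters.\<close>

lemma length_words [simp]: "length (words l) = 2 ^ l"
  by (induction l) auto

lemma set_words: "set (words l) = {w. length w = l}"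
proof (induction l)
  case (Suc l)
  show ?case
  proof (intro Set.set_eqI iffI)
    fix w :: "letter list" assume "w \<in> {w. length w = Suc l}"
    then obtain B v where "w = B # v" "length v = l" by (cases w) auto
    then show "w \<in> set (words (Suc l))" by (cases B) (auto simp: Suc)
  qed (auto simp: Suc)
qed auto

lemma distinct_words: "distinct (words l)"
  by (induction l) (auto simp: distinct_map)

lemma length_nth_words [simp]: "k < 2 ^ l \<Longrightarrow> length (words l ! k) = l"
  using nth_mem[of k "words l"] by (simp add: set_words)

lemma word_basis_Suc_conv: "1 \<le> n \<Longrightarrow> word_basis n = words n @ word_basis (n - 1)"
  by (cases n) auto

lemma length_word_basis: "length (word_basis n) = 2 ^ (n + 1) - 1"
  by (induction n) auto

lemma set_word_basis: "set (word_basis n) = {w. length w \<le> n}"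
proof (induction n)
  case (Suc n)
  have "set (word_basis (Suc n)) = {w. length w = Suc n} \<union> {w. length w \<le> n}"
    by (simp only: word_basis.simps set_append set_words Suc)
  then show ?case by (auto simp: le_Suc_eq)
qed (simp add: set_words del: words.simps)

lemma distinct_word_basis: "distinct (word_basis n)"
  by (induction n) (auto simp: distinct_words set_words set_word_basis simp del: words.simps(2))

text \<open>Turns the index sums of matrix products into sums over words, where splitting off
  prefixes and suffixes makes sense.\<close>

lemma sum_word_basis:
  "(\<Sum>k<length (word_basis n). f (word_basis n ! k)) = (\<Sum>x | length x \<le> n. f x)"
proof -
  have "bij_betw (nth (word_basis n)) {..<length (word_basis n)} {x. length x \<le> n}"
    by (intro bij_betw_nth) (auto simp: distinct_word_basis set_word_basis)
  then show ?thesis by (rule sum.reindex_bij_betw)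
qed

lemma finite_words_le [simp]: "finite {x :: letter list. length x \<le> n}"
  unfolding set_word_basis[symmetric] by simp

section \<open>Binary indices: quotient and remainder as prefix and suffix\<close>

lemma nth_words_append:
  assumes "r < 2 ^ l" "a < 2 ^ i"
  shows "words (l + i) ! (r * 2 ^ i + a) = words l ! r @ words i ! a"
  using assms
proof (induction l arbitrary: r)
  case (Suc l)
  have lt: "r' * 2 ^ i + a < 2 ^ (l + i)" if "r' < 2 ^ l" for r'
  proof -
    have "r' * 2 ^ i + a < (r' + 1) * 2 ^ i" using Suc.prems by simp
    also have "\<dots> \<le> 2 ^ l * 2 ^ i" using that by (intro mult_right_mono) auto
    finally show ?thesis by (simp add: power_add)
  qed
  show ?case
  proof (cases "r < 2 ^ l")
    case True
    then show ?thesis using Suc lt[of r] by (simp add: nth_append)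
  next
    case False
    define r' where "r' = r - 2 ^ l"
    have r: "r = 2 ^ l + r'" "r' < 2 ^ l" using False Suc.prems by (auto simp: r'_def)
    have "r * 2 ^ i + a = 2 ^ (l + i) + (r' * 2 ^ i + a)" by (simp add: r power_add algebra_simps)
    then show ?thesis using Suc.IH[of r'] Suc.prems lt[of r'] r by (simp add: nth_append)
  qed
qed auto

text \<open>There are \<open>2 ^ i\<close> times as many words of length l + i as of length l, and
  lengths decrease along both lists. So \<open>word_basis (m + i)\<close>, down to the words of
  length \<open>i\<close>, is \<open>word_basis m\<close> with each word u replaced by the words u @
  v with v of length \<open>i\<close>. The bound on \<open>r\<close> stops just before the shorter
  words.\<close>

lemma nth_word_basis_append:
  assumes "r < 2 ^ (m + 1) - 1" "a < 2 ^ i"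
  shows "word_basis (m + i) ! (r * 2 ^ i + a) = word_basis m ! r @ words i ! a"
  using assms
proof (induction m arbitrary: r)
  case 0
  then show ?case by (cases i) (auto simp: nth_append)
next
  case (Suc m)
  show ?case
  proof (cases "r < 2 ^ Suc m")
    case True
    have "r * 2 ^ i + a < (r + 1) * 2 ^ i" using Suc.prems by simp
    also have "\<dots> \<le> 2 ^ Suc m * 2 ^ i" using True by (intro mult_right_mono) auto
    finally have "r * 2 ^ i + a < 2 ^ (Suc m + i)" by (simp add: power_add)
    then show ?thesis using nth_words_append[of r "Suc m" a i] Suc.prems True
      by (simp add: nth_append del: words.simps)
  next
    case False
    define r' where "r' = r - 2 ^ Suc m"
    have r: "r = 2 ^ Suc m + r'" "r' < 2 ^ Suc m - 1" using False Suc.prems by (auto simp: r'_def)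
    have "r * 2 ^ i + a = 2 ^ (Suc m + i) + (r' * 2 ^ i + a)"
      by (simp add: r(1) power_add algebra_simps)
    then show ?thesis using Suc.IH[of r'] Suc.prems r by (simp add: nth_append del: words.simps)
  qed
qed

text \<open>Behind the \<open>2 ^ (m + 1) - 1\<close> full blocks of height \<open>2 ^ i\<close>
  only \<open>2 ^ i - 1\<close> places remain, those of the words shorter than \<open>i\<close>.
  They are the last, shorter row block of the matrices of forms.\<close>

lemma length_nth_word_basis_tail:
  assumes "a < 2 ^ i - 1"
  shows "length (word_basis (m + i) ! ((2 ^ (m + 1) - 1) * 2 ^ i + a)) < i"
  using assms
proof (induction m)
  case 0
  then obtain j where i: "i = Suc j" by (cases i) auto
  have "word_basis i ! (2 ^ i + a) = word_basis j ! a" by (simp add: i nth_append)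
  moreover have "word_basis j ! a \<in> set (word_basis j)"
    using 0 by (intro nth_mem) (simp add: length_word_basis i)
  ultimately show ?case by (simp add: set_word_basis i)
next
  case (Suc m)
  have "(2 ^ (Suc m + 1) - 1 :: nat) = 2 ^ Suc m + (2 ^ (m + 1) - 1)" by simp
  then have "(2 ^ (Suc m + 1) - 1) * 2 ^ i + a = 2 ^ (Suc m + i) + ((2 ^ (m + 1) - 1) * 2 ^ i + a)"
    by (simp only: power_add distrib_right add.assoc)
  then show ?case using Suc by (simp add: nth_append del: words.simps)
qed

text \<open>Counted from 0, the full block \<open>2 ^ (m + 1) - 2\<close> has the empty prefix, so
  it consists of the words of length \<open>i\<close> themselves. This locates both the columns of
  block \<open>i\<close> and the zero block of (B2).\<close>

lemma last_word_basis: "word_basis m ! (2 ^ (m + 1) - 2) = []"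
proof (induction m)
  case (Suc m)
  have "(2::nat) ^ (Suc m + 1) - 2 = 2 ^ Suc m + (2 ^ (m + 1) - 2)" by simp
  then have "word_basis (Suc m) ! (2 ^ (Suc m + 1) - 2) = word_basis m ! (2 ^ (m + 1) - 2)"
    by (metis length_words nth_append_length_plus word_basis.simps(2))
  then show ?case using Suc by simp
qed auto

text \<open>The words of length \<open>i\<close> come after all longer ones. Their offset is a
  multiple of \<open>2 ^ i\<close>, so the description of row blocks by prefixes applies to the
  columns as well.\<close>

lemma sum_powers_block:
  assumes "i \<le> n"
  shows "(\<Sum>j\<in>{i<..n}. 2 ^ j) = (2 ^ (n - i + 1) - 2) * (2 ^ i :: nat)"
  using assms
proof (induction n rule: dec_induct)
  case (step n)
  have "{i<..Suc n} = insert (Suc n) {i<..n}" using step by auto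
  moreover have "(2::nat) ^ Suc n = 2 ^ (n - i + 1) * 2 ^ i"
    using step by (simp flip: power_add)
  ultimately show ?case using step by (simp add: Suc_diff_le algebra_simps)
qed auto

lemma nth_word_basis_column_block:
  assumes "i \<le> n" "b < 2 ^ i"
  shows "word_basis n ! ((\<Sum>j\<in>{i<..n}. 2 ^ j) + b) = words i ! b"
proof -
  have "1 \<le> (2::nat) ^ (n - i)" by simp
  then have "2 ^ (n - i + 1) - 2 < 2 ^ (n - i + 1) - (1::nat)"
    unfolding power_add power_one_right by linarith
  then have "word_basis (n - i + i) ! ((2 ^ (n - i + 1) - 2) * 2 ^ i + b) = words i ! b"
    by (subst nth_word_basis_append) (use assms last_word_basis[of "n - i"] in auto)
  then show ?thesis using assms by (simp add: sum_powers_block)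
qed

section \<open>Products and inverses of noncommutative power series\<close>

definition concat_coeff :: "(letter list \<Rightarrow> 'a::zero) \<Rightarrow> letter list \<Rightarrow> letter list \<Rightarrow> 'a" where
  \<comment> \<open>the coefficient of \<open>w\<close> in the product of the power series \<open>a\<close> with the word \<open>v\<close>\<close>
  "concat_coeff a w v =
     (if \<exists>u. w = u @ v then a (take (length w - length v) w) else 0)"

lemma concat_coeff_append [simp]: "concat_coeff a (u @ v) v = a u"
  by (auto simp: concat_coeff_def)

lemma concat_coeff_self [simp]: "concat_coeff a w w = a []"
  using concat_coeff_append[of a "[]" w] by simp

lemma concat_coeff_same_length:
  "length v = length v' \<Longrightarrow> concat_coeff a (u @ v) v' = (if v = v' then a u else 0)"
  by (auto simp: concat_coeff_def)

lemma concat_coeff_longer: "length w < length v \<Longrightarrow> concat_coeff a w v = 0"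
  by (auto simp: concat_coeff_def)

lemma concat_coeff_not_suffix: "\<nexists>u. w = u @ v \<Longrightarrow> concat_coeff a w v = 0"
  by (simp add: concat_coeff_def)

lemma concat_coeff_in: "0 \<in> S \<Longrightarrow> (\<And>u. a u \<in> S) \<Longrightarrow> concat_coeff a w v \<in> S"
  by (auto simp: concat_coeff_def)

text \<open>The multiplication \<open>f\<close> is a parameter, so that function times function,
  function times form and form times function are instances of one product and share one
  computation.\<close>

definition convolve ::
  "('a \<Rightarrow> 'b \<Rightarrow> 'c::comm_monoid_add) \<Rightarrow> (letter list \<Rightarrow> 'a) \<Rightarrow> (letter list \<Rightarrow> 'b) \<Rightarrow> letter list \<Rightarrow> 'c"
  where "convolve f a b w = (\<Sum>k\<le>length w. f (a (take k w)) (b (drop k w)))"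

text \<open>A word x contributes only if v is a suffix of x and x is a suffix of w. With w = u @ v
  these are the words \<open>drop k u @ v\<close>, and summing over k gives the convolution at u.
  None of them is lost by truncation, because w has length at most n.\<close>

lemma concat_coeff_convolve:
  assumes f: "\<And>y. f 0 y = 0" "\<And>x. f x 0 = 0" and w: "length w \<le> n"
  shows "(\<Sum>x | length x \<le> n. f (concat_coeff a w x) (concat_coeff b x v)) =
    concat_coeff (convolve f a b) w v"
proof (cases "\<exists>u. w = u @ v")
  case True
  then obtain u where u: "w = u @ v" ..
  let ?h = "\<lambda>k. drop k u @ v"
  have inj: "inj_on ?h {..length u}"
    by (rule inj_onI) (metis append_same_eq atMost_iff diff_diff_cancel length_drop)
  have "(\<Sum>x | length x \<le> n. f (concat_coeff a w x) (concat_coeff b x v)) =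
      (\<Sum>x\<in>?h ` {..length u}. f (concat_coeff a w x) (concat_coeff b x v))"
  proof (rule sum.mono_neutral_right)
    show "?h ` {..length u} \<subseteq> {x. length x \<le> n}" using w u by auto
    show "\<forall>x\<in>{x. length x \<le> n} - ?h ` {..length u}.
        f (concat_coeff a w x) (concat_coeff b x v) = 0"
    proof
      fix x assume x: "x \<in> {x. length x \<le> n} - ?h ` {..length u}"
      show "f (concat_coeff a w x) (concat_coeff b x v) = 0"
      proof (cases "\<exists>u. x = u @ v")
        case True
        then obtain u' where x': "x = u' @ v" ..
        show ?thesis
        proof (cases "\<exists>u. w = u @ x")
          case True
          then obtain u'' where w': "w = u'' @ x" ..
          have "x = ?h (length u'')" "length u'' \<in> {..length u}" using x' w' u by auto
          then show ?thesis using x by blast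
        qed (simp add: f concat_coeff_not_suffix)
      qed (simp add: f concat_coeff_not_suffix)
    qed
  qed simp
  also have "\<dots> = (\<Sum>k\<le>length u. f (concat_coeff a w (?h k)) (concat_coeff b (?h k) v))"
    using inj by (simp add: sum.reindex)
  also have "\<dots> = (\<Sum>k\<le>length u. f (a (take k u)) (b (drop k u)))"
  proof (rule sum.cong)
    fix k assume "k \<in> {..length u}"
    have "concat_coeff a (take k u @ ?h k) (?h k) = a (take k u)" by (rule concat_coeff_append)
    moreover have "take k u @ ?h k = w" using u by (metis append_assoc append_take_drop_id)
    ultimately show "f (concat_coeff a w (?h k)) (concat_coeff b (?h k) v) =
        f (a (take k u)) (b (drop k u))" by simp
  qed simp
  finally show ?thesis by (simp add: u convolve_def)
next
  case False
  have "f (concat_coeff a w x) (concat_coeff b x v) = 0" for x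
  proof (cases "\<exists>u. x = u @ v")
    case True
    then obtain u' where x': "x = u' @ v" ..
    show ?thesis
    proof (cases "\<exists>u. w = u @ x")
      case True
      then obtain u'' where w': "w = u'' @ x" ..
      then show ?thesis using x' False by simp
    qed (simp add: f concat_coeff_not_suffix)
  qed (simp add: f concat_coeff_not_suffix)
  then show ?thesis using False by (simp add: concat_coeff_not_suffix)
qed

text \<open>Solves the vanishing of the coefficient of g^(-1) g at w for its last term, whose second
  factor is the constant term 1 of g. This is a left inverse; on the other side it is obtained later
  from the matrices being square.\<close>

function inverse_series :: "(letter list \<Rightarrow> 'a::ring_1) \<Rightarrow> letter list \<Rightarrow> 'a" where
  "inverse_series g w =
     (if w = [] then 1 else - (\<Sum>k<length w. inverse_series g (take k w) * g (drop k w)))"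
  by auto
termination by (relation "measure (length \<circ> snd)") auto

declare inverse_series.simps [simp del]

lemma inverse_series_Nil [simp]: "inverse_series g [] = 1"
  by (simp add: inverse_series.simps)

lemma convolve_inverse_series:
  assumes "g [] = 1"
  shows "convolve (*) (inverse_series g) g w = (if w = [] then 1 else 0)"
proof (cases "w = []")
  case False
  have "convolve (*) (inverse_series g) g w =
      inverse_series g w * g [] + (\<Sum>k<length w. inverse_series g (take k w) * g (drop k w))"
    by (simp add: convolve_def lessThan_Suc_atMost[symmetric] add.commute)
  then show ?thesis using False assms by (simp add: inverse_series.simps[of g w])
qed (simp add: convolve_def assms)

text \<open>The choice of g by recursion on word length knows g only on shorter words; by this
  locality the inverse is known there too.\<close>

lemma inverse_series_cong:
  assumes "\<And>v. length v \<le> n \<Longrightarrow> g v = h v" "length w \<le> n"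
  shows "inverse_series g w = inverse_series h w"
  using assms(2)
proof (induction w rule: length_induct)
  case (1 w)
  have "(\<Sum>k<length w. inverse_series g (take k w) * g (drop k w)) =
      (\<Sum>k<length w. inverse_series h (take k w) * h (drop k w))"
    using 1 assms(1) by (intro sum.cong) auto
  then show ?case by (simp add: inverse_series.simps[of _ w])
qed

section \<open>Matrices of left multiplications\<close>

text \<open>The series is given on all words; the level n only selects finitely many rows and
  columns of one infinite matrix.\<close>

definition left_mult_matrix :: "nat \<Rightarrow> (letter list \<Rightarrow> 'a::zero) \<Rightarrow> 'a mat" where
  "left_mult_matrix n a =
     mat (length (word_basis n)) (length (word_basis n))
       (\<lambda>(i, j). concat_coeff a (word_basis n ! i) (word_basis n ! j))"

lemma left_mult_matrix_carrier [simp]: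
  "left_mult_matrix n a \<in> carrier_mat (2 ^ (n + 1) - 1) (2 ^ (n + 1) - 1)"
  "dim_row (left_mult_matrix n a) = 2 ^ (n + 1) - 1"
  "dim_col (left_mult_matrix n a) = 2 ^ (n + 1) - 1"
  by (simp_all add: left_mult_matrix_def length_word_basis)

lemma index_left_mult_matrix:
  "i < 2 ^ (n + 1) - 1 \<Longrightarrow> j < 2 ^ (n + 1) - 1 \<Longrightarrow>
    left_mult_matrix n a $$ (i, j) = concat_coeff a (word_basis n ! i) (word_basis n ! j)"
  by (simp add: left_mult_matrix_def length_word_basis)

lemma length_nth_word_basis: "i < 2 ^ (n + 1) - 1 \<Longrightarrow> length (word_basis n ! i) \<le> n"
  using nth_mem[of i "word_basis n"] by (simp add: set_word_basis length_word_basis)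

lemma nth_word_basis_inject:
  "i < 2 ^ (n + 1) - 1 \<Longrightarrow> j < 2 ^ (n + 1) - 1 \<Longrightarrow>
    word_basis n ! i = word_basis n ! j \<longleftrightarrow> i = j"
  using nth_eq_iff_index_eq[OF distinct_word_basis, of i n j] by (simp add: length_word_basis)

lemma nth_words_inject: "i < 2 ^ n \<Longrightarrow> j < 2 ^ n \<Longrightarrow> words n ! i = words n ! j \<longleftrightarrow> i = j"
  using nth_eq_iff_index_eq[OF distinct_words, of i n j] by simp

lemma left_mult_matrix_carrier_dim:
  "left_mult_matrix n a \<in> carrier_mat (dim_row (left_mult_matrix n b)) (dim_row (left_mult_matrix n b))"
  by (rule carrier_matI) simp_all

text \<open>Formulated for entries and a general \<open>f\<close>, because the product of matrices
  of functions and the two mixed products with matrices of forms are different constants that sum in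
  the same way.\<close>

lemma sum_left_mult_matrix:
  assumes f: "\<And>y. f 0 y = 0" "\<And>x. f x 0 = 0"
    and i: "i < 2 ^ (n + 1) - 1" and j: "j < 2 ^ (n + 1) - 1"
  shows "(\<Sum>k<2 ^ (n + 1) - 1. f (left_mult_matrix n a $$ (i, k)) (left_mult_matrix n b $$ (k, j))) =
    left_mult_matrix n (convolve f a b) $$ (i, j)"
proof -
  let ?w = "word_basis n ! i" and ?v = "word_basis n ! j"
  have "(\<Sum>k<2 ^ (n + 1) - 1. f (left_mult_matrix n a $$ (i, k)) (left_mult_matrix n b $$ (k, j))) =
      (\<Sum>k<length (word_basis n). f (concat_coeff a ?w (word_basis n ! k)) (concat_coeff b (word_basis n ! k) ?v))"
    using i j by (intro sum.cong) (auto simp: index_left_mult_matrix length_word_basis)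
  also have "\<dots> = (\<Sum>x | length x \<le> n. f (concat_coeff a ?w x) (concat_coeff b x ?v))"
    by (rule sum_word_basis)
  also have "\<dots> = concat_coeff (convolve f a b) ?w ?v"
    using f length_nth_word_basis[OF i] by (rule concat_coeff_convolve)
  finally show ?thesis using i j by (simp add: index_left_mult_matrix)
qed

lemma left_mult_matrix_mult:
  "left_mult_matrix n a * left_mult_matrix n b =
    left_mult_matrix n (convolve (*) a (b :: letter list \<Rightarrow> 'a::semiring_0))"
proof (rule eq_matI)
  fix i j assume "i < dim_row (left_mult_matrix n (convolve (*) a b))"
    "j < dim_col (left_mult_matrix n (convolve (*) a b))"
  then show "(left_mult_matrix n a * left_mult_matrix n b) $$ (i, j) =
      left_mult_matrix n (convolve (*) a b) $$ (i, j)"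
    using sum_left_mult_matrix[of "(*)" i n j a b]
    by (simp add: scalar_prod_def atLeast0LessThan)
qed simp_all

lemma fun_form_mult_left_mult_matrix:
  assumes "\<And>\<omega>. smul C 0 \<omega> = 0" "\<And>g. smul C g 0 = 0"
  shows "fun_form_mult C (left_mult_matrix n a) (left_mult_matrix n b) =
    left_mult_matrix n (convolve (smul C) a b)"
  using sum_left_mult_matrix[of "smul C" _ n _ a b] assms
  by (intro eq_matI) (simp_all add: fun_form_mult_def)

lemma form_fun_mult_left_mult_matrix:
  assumes "\<And>\<omega>. smul C 0 \<omega> = 0" "\<And>g. smul C g 0 = 0"
  shows "form_fun_mult C (left_mult_matrix n a) (left_mult_matrix n b) =
    left_mult_matrix n (convolve (\<lambda>\<omega> g. smul C g \<omega>) a b)"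
  using sum_left_mult_matrix[of "\<lambda>\<omega> g. smul C g \<omega>" _ n _ a b] assms
  by (intro eq_matI) (simp_all add: form_fun_mult_def)

lemma left_mult_matrix_one:
  assumes "a [] = 1" "\<And>w. w \<noteq> [] \<Longrightarrow> a w = (0 :: 'a::zero_neq_one)"
  shows "left_mult_matrix n a = 1\<^sub>m (2 ^ (n + 1) - 1)"
proof (rule eq_matI)
  fix i j assume "i < dim_row (1\<^sub>m (2 ^ (n + 1) - 1) :: 'a mat)" "j < dim_col (1\<^sub>m (2 ^ (n + 1) - 1) :: 'a mat)"
  then have ij: "i < 2 ^ (n + 1) - 1" "j < 2 ^ (n + 1) - 1" by simp_all
  have "concat_coeff a w v = (if w = v then 1 else 0)" for w v
  proof (cases "\<exists>u. w = u @ v")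
    case True
    then obtain u where u: "w = u @ v" ..
    show ?thesis using assms by (cases "u = []") (simp_all add: u)
  qed (auto simp: concat_coeff_not_suffix)
  then show "left_mult_matrix n a $$ (i, j) = 1\<^sub>m (2 ^ (n + 1) - 1) $$ (i, j)"
    using ij by (simp add: index_left_mult_matrix nth_word_basis_inject del: One_nat_def)
qed simp_all

lemma map_left_mult_matrix:
  "D 0 = 0 \<Longrightarrow> map_mat D (left_mult_matrix n a) = left_mult_matrix n (\<lambda>w. D (a w))"
  by (rule eq_matI) (auto simp: index_left_mult_matrix concat_coeff_def)

lemma left_mult_matrix_add:
  "left_mult_matrix n a + left_mult_matrix n b =
    left_mult_matrix n (\<lambda>w. a w + b w :: 'a::monoid_add)"
  by (rule eq_matI) (auto simp: index_left_mult_matrix concat_coeff_def)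

lemma elements_left_mult_matrix:
  "x \<in> elements_mat (left_mult_matrix n a) \<Longrightarrow> 0 \<in> S \<Longrightarrow> (\<And>w. a w \<in> S) \<Longrightarrow> x \<in> S"
  by (auto simp: index_left_mult_matrix dest!: elements_matD intro!: concat_coeff_in)

section \<open>The connection as a left multiplication\<close>

definition connection_series :: "'w \<Rightarrow> 'w \<Rightarrow> letter list \<Rightarrow> 'w::ab_group_add" where
  "connection_series \<alpha>0 \<alpha>1 w = (if w = [A0] then - \<alpha>0 else if w = [A1] then - \<alpha>1 else 0)"

text \<open>Basis words have constant coefficients, so d contributes nothing and only -A remains.
  The cut-off in \<open>left_mult\<close> is invisible here, as the rows are words of length at most
  n.\<close>

lemma connection_matrix_nabla:
  fixes C :: "('k, 'f::field, 'w::ab_group_add) curve"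
  assumes "\<And>\<omega>. smul C 0 \<omega> = 0" "\<And>\<omega>. smul C 1 \<omega> = \<omega>" "dif C 0 = 0" "dif C 1 = 0"
  shows "connection_matrix n (nabla C \<alpha>0 \<alpha>1 n) = left_mult_matrix n (connection_series \<alpha>0 \<alpha>1)"
proof -
  have "nabla C \<alpha>0 \<alpha>1 n (\<lambda>x. if x = v then 1 else 0) w =
      concat_coeff (connection_series \<alpha>0 \<alpha>1) w v" if "length w \<le> n" for w v
  proof (cases w)
    case Nil
    then show ?thesis using assms
      by (auto simp: nabla_def left_mult_def concat_coeff_def connection_series_def)
  next
    case (Cons B w')
    show ?thesis
    proof (cases "w' = v")
      case True
      then have "w = [B] @ v" using Cons by simp
      then have "concat_coeff (connection_series \<alpha>0 \<alpha>1) w v = connection_series \<alpha>0 \<alpha>1 [B]"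
        by (simp only: concat_coeff_append)
      then show ?thesis using assms Cons that True
        by (cases B) (auto simp: nabla_def left_mult_def connection_series_def)
    next
      case False
      have "concat_coeff (connection_series \<alpha>0 \<alpha>1) w v = 0"
      proof (cases "\<exists>u. w = u @ v")
        case True
        then show ?thesis using False Cons by (auto simp: connection_series_def)
      qed (simp add: concat_coeff_not_suffix)
      then show ?thesis using assms Cons False by (auto simp: nabla_def left_mult_def)
    qed
  qed
  then show ?thesis
    by (intro eq_matI) (simp_all add: connection_matrix_def length_word_basis
        index_left_mult_matrix length_nth_word_basis)
qed

section \<open>Block shapes of the matrices of left multiplications\<close>

lemma word_block_index_less:
  assumes "r < 2 ^ (m + 1) - 1" "a < 2 ^ i"
  shows "r * 2 ^ i + a < 2 ^ (m + i + 1) - (1::nat)"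
proof -
  have "r * 2 ^ i + a < (r + 1) * 2 ^ i" using assms by simp
  also have "(r + 1) * 2 ^ i \<le> (2 ^ (m + 1) - 1) * 2 ^ i"
    using assms by (intro mult_right_mono) auto
  also have "\<dots> = 2 ^ (m + i + 1) - 2 ^ i" by (simp add: power_add diff_mult_distrib)
  also have "\<dots> \<le> 2 ^ (m + i + 1) - 1" by (intro diff_le_mono2) simp
  finally show ?thesis .
qed

lemma column_block_index_less:
  assumes "i \<le> n" "b < 2 ^ i"
  shows "(\<Sum>j\<in>{i<..n}. 2 ^ j) + b < 2 ^ (n + 1) - (1::nat)"
proof -
  have "1 \<le> (2::nat) ^ (n - i)" by simp
  then have "2 ^ (n - i + 1) - 2 < 2 ^ (n - i + 1) - (1::nat)"
    unfolding power_add power_one_right by linarith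
  from word_block_index_less[OF this assms(2)] show ?thesis
    using assms by (simp add: sum_powers_block)
qed

lemma C_block_left_mult_matrix:
  assumes "i \<le> n" "1 \<le> r" "r \<le> 2 ^ (n + 1 - i) - 1"
  shows "C_block n (left_mult_matrix n c) r i =
    scalar_form_mat (2 ^ i) (c (word_basis (n - i) ! (r - 1)))"
proof -
  obtain m where n: "n = m + i" using assms by (metis le_add_diff_inverse2)
  have r: "r - 1 < 2 ^ (m + 1) - 1" "r \<noteq> 2 ^ (m + 1)" using assms by (auto simp: n Suc_diff_le)
  have "left_mult_matrix n c $$ ((r - 1) * 2 ^ i + a, (\<Sum>j\<in>{i<..n}. 2 ^ j) + b) =
      (if a = b then c (word_basis m ! (r - 1)) else 0)" if ab: "a < 2 ^ i" "b < 2 ^ i" for a b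
  proof -
    have "left_mult_matrix n c $$ ((r - 1) * 2 ^ i + a, (\<Sum>j\<in>{i<..n}. 2 ^ j) + b) =
        concat_coeff c (word_basis m ! (r - 1) @ words i ! a) (words i ! b)"
      using word_block_index_less[OF r(1) ab(1)] column_block_index_less[OF assms(1) ab(2)]
        nth_word_basis_append[OF r(1) ab(1)] nth_word_basis_column_block[OF assms(1) ab(2)]
      by (simp add: index_left_mult_matrix n)
    also have "\<dots> = (if a = b then c (word_basis m ! (r - 1)) else 0)"
      using ab by (simp add: concat_coeff_same_length nth_words_inject)
    finally show ?thesis .
  qed
  then show ?thesis using r
    by (intro eq_matI) (auto simp: C_block_def block_def scalar_form_mat_def n Suc_diff_le)
qed

text \<open>The row words are shorter than \<open>i\<close>, so no column word of length
  \<open>i\<close> is a suffix of one of them.\<close>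

lemma C_block_left_mult_matrix_last:
  assumes "i \<le> n"
  shows "C_block n (left_mult_matrix n c) (2 ^ (n + 1 - i)) i = 0\<^sub>m (2 ^ i - 1) (2 ^ i)"
proof -
  obtain m where n: "n = m + i" using assms by (metis le_add_diff_inverse2)
  have "left_mult_matrix n c $$ ((2 ^ (m + 1) - 1) * 2 ^ i + a, (\<Sum>j\<in>{i<..n}. 2 ^ j) + b) = 0"
    if ab: "a < 2 ^ i - 1" "b < 2 ^ i" for a b
  proof -
    have "(2 ^ (m + 1) - 1) * 2 ^ i + a < 2 ^ (n + 1) - (1::nat)"
    proof -
      have "(2::nat) ^ i \<le> 2 ^ (m + 1 + i)" by (intro power_increasing) auto
      then have "(2 ^ (m + 1 + i) - 2 ^ i) + a < 2 ^ (m + 1 + i) - (1::nat)"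
        using ab(1) by linarith
      then show ?thesis by (simp add: n power_add diff_mult_distrib)
    qed
    then show ?thesis
      using column_block_index_less[OF assms ab(2)] length_nth_word_basis_tail[OF ab(1), of m]
        nth_word_basis_column_block[OF assms ab(2)] ab(2)
      by (simp add: index_left_mult_matrix n concat_coeff_longer)
  qed
  then show ?thesis
    by (intro eq_matI) (auto simp: C_block_def block_def n Suc_diff_le)
qed

text \<open>The four blocks come from splitting the basis into words of length n and shorter ones.
  Words of equal length interact only through \<open>g [] = 1\<close>, a row word shorter than the
  column word gives 0, and the shorter words among themselves give the matrix one level
  down.\<close>

lemma left_mult_matrix_four_block:
  fixes g :: "letter list \<Rightarrow> 'a::semiring_1"
  assumes "1 \<le> n" "g [] = 1"
  obtains H where "H \<in> carrier_mat (2 ^ n) (2 ^ n - 1)"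
    "left_mult_matrix n g =
      four_block_mat (1\<^sub>m (2 ^ n)) H (0\<^sub>m (2 ^ n - 1) (2 ^ n)) (left_mult_matrix (n - 1) g)"
    "\<And>i r. i < n \<Longrightarrow> r \<in> {1..2 ^ (n - i)} \<Longrightarrow>
      H_block n H r i = g (words (n - i) ! (r - 1)) \<cdot>\<^sub>m 1\<^sub>m (2 ^ i)"
proof
  define H where "H = mat (2 ^ n) (2 ^ n - 1)
    (\<lambda>(i, j). concat_coeff g (words n ! i) (word_basis (n - 1) ! j))"
  obtain k where n: "n = Suc k" using assms by (cases n) auto
  show "H \<in> carrier_mat (2 ^ n) (2 ^ n - 1)" by (simp add: H_def)
  show "left_mult_matrix n g =
      four_block_mat (1\<^sub>m (2 ^ n)) H (0\<^sub>m (2 ^ n - 1) (2 ^ n)) (left_mult_matrix (n - 1) g)"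
  proof (rule eq_matI)
    fix i j
    assume "i < dim_row (four_block_mat (1\<^sub>m (2 ^ n)) H (0\<^sub>m (2 ^ n - 1) (2 ^ n)) (left_mult_matrix (n - 1) g))"
      "j < dim_col (four_block_mat (1\<^sub>m (2 ^ n)) H (0\<^sub>m (2 ^ n - 1) (2 ^ n)) (left_mult_matrix (n - 1) g))"
    then have ij: "i < 2 ^ (n + 1) - 1" "j < 2 ^ (n + 1) - 1"
      by (simp_all add: H_def n)
    have wb: "word_basis n ! k = (if k < 2 ^ n then words n ! k else word_basis (n - 1) ! (k - 2 ^ n))" for k
      using assms by (simp add: word_basis_Suc_conv nth_append)
    have low: "length (word_basis (n - 1) ! (k - 2 ^ n)) < n"
      if "\<not> k < 2 ^ n" "k < 2 ^ (n + 1) - 1" for k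
      using length_nth_word_basis[of "k - 2 ^ n" "n - 1"] that by (simp add: n) linarith
    have one: "concat_coeff g (words n ! i) (words n ! j) = (if i = j then 1 else 0)"
      if "i < 2 ^ n" "j < 2 ^ n"
      using concat_coeff_same_length[of "words n ! i" "words n ! j" g "[]"] that assms
      by (simp add: nth_words_inject)
    have zero: "concat_coeff g (word_basis (n - 1) ! (i - 2 ^ n)) (words n ! j) = 0"
      if "\<not> i < 2 ^ n" "j < 2 ^ n"
      using low[of i] that ij by (simp add: concat_coeff_longer)
    have lt: "i - 2 ^ n < 2 ^ n - 1 \<or> i < 2 ^ n" "j - 2 ^ n < 2 ^ n - 1 \<or> j < 2 ^ n"
      using ij by auto
    have n1: "n - 1 + 1 = n" using assms by simp
    have ij': "i < 2 ^ n + (2 ^ n - 1)" "j < 2 ^ n + (2 ^ n - 1)" using ij by auto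
    have sub: "left_mult_matrix (n - 1) g $$ (i - 2 ^ n, j - 2 ^ n) =
        concat_coeff g (word_basis (n - 1) ! (i - 2 ^ n)) (word_basis (n - 1) ! (j - 2 ^ n))"
      if "\<not> i < 2 ^ n" "\<not> j < 2 ^ n"
      using lt that by (intro index_left_mult_matrix) (auto simp: n)
    show "left_mult_matrix n g $$ (i, j) =
        four_block_mat (1\<^sub>m (2 ^ n)) H (0\<^sub>m (2 ^ n - 1) (2 ^ n)) (left_mult_matrix (n - 1) g) $$ (i, j)"
      using ij ij' lt
      by (cases "i < 2 ^ n"; cases "j < 2 ^ n")
        (simp_all add: index_left_mult_matrix wb one zero sub H_def n1 del: One_nat_def)
  qed (simp_all add: H_def n)
  fix i r :: nat assume i: "i < n" and r: "r \<in> {1..2 ^ (n - i)}"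
  show "H_block n H r i = g (words (n - i) ! (r - 1)) \<cdot>\<^sub>m 1\<^sub>m (2 ^ i)"
  proof -
    have r': "r - 1 < 2 ^ (n - i)" using r by auto
    have "H $$ ((r - 1) * 2 ^ i + a, (\<Sum>j\<in>{i<..<n}. 2 ^ j) + b) =
        (if a = b then g (words (n - i) ! (r - 1)) else 0)" if ab: "a < 2 ^ i" "b < 2 ^ i" for a b
    proof -
      \<comment> \<open>The columns of \<open>H\<close> begin with the words of length n - 1, so
        their offsets are those of level n - 1, while its rows are words of length n.\<close>
      have "{i<..<n} = {i<..n - 1}" using assms by auto
      then have col: "(\<Sum>j\<in>{i<..<n}. 2 ^ j) + b < 2 ^ n - 1"
          "word_basis (n - 1) ! ((\<Sum>j\<in>{i<..<n}. 2 ^ j) + b) = words i ! b"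
        using column_block_index_less[of i "n - 1" b] nth_word_basis_column_block[of i "n - 1" b] i ab
        by (auto simp: n)
      have "(r - 1) * 2 ^ i + a < (r - 1 + 1) * 2 ^ i" using ab by simp
      also have "\<dots> \<le> 2 ^ (n - i) * 2 ^ i" using r' by (intro mult_right_mono) auto
      also have "\<dots> = 2 ^ n" using i by (simp flip: power_add)
      finally have row: "(r - 1) * 2 ^ i + a < 2 ^ n" .
      have "words n ! ((r - 1) * 2 ^ i + a) = words (n - i) ! (r - 1) @ words i ! a"
        using nth_words_append[OF r' ab(1)] i by simp
      then show ?thesis using row col ab
        by (simp add: H_def concat_coeff_same_length nth_words_inject del: One_nat_def)
    qed
    then show ?thesis by (intro eq_matI) (auto simp: H_block_def block_def)
  qed
qed

section \<open>Compatibility with the projection to the lower level\<close>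

lemma projection_matrix_carrier:
  assumes "1 \<le> n"
  shows "projection_matrix (n - 1) \<in> carrier_mat (2 ^ n - 1) (2 ^ (n + 1) - 1)"
  using assms by (cases n) (simp_all add: projection_matrix_def length_word_basis del: word_basis.simps)

lemma index_projection_matrix:
  assumes "1 \<le> n" "i < 2 ^ n - 1" "j < 2 ^ (n + 1) - 1"
  shows "projection_matrix (n - 1) $$ (i, j) =
    (if word_basis (n - 1) ! i = word_basis n ! j then 1 else 0)"
  using assms by (cases n) (simp_all add: projection_matrix_def length_word_basis del: word_basis.simps)

lemma sum_projection_left:
  assumes n: "1 \<le> n" and f: "\<And>y. f 0 y = 0" "\<And>y. f 1 y = y"
    and i: "i < 2 ^ n - 1" and j: "j < 2 ^ (n + 1) - 1"
  shows "(\<Sum>k<2 ^ (n + 1) - 1. f (projection_matrix (n - 1) $$ (i, k)) (left_mult_matrix n a $$ (k, j))) =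
    concat_coeff a (word_basis (n - 1) ! i) (word_basis n ! j)"
proof -
  let ?w = "word_basis (n - 1) ! i" and ?v = "word_basis n ! j"
  have "length ?w \<le> n" using length_nth_word_basis[of i "n - 1"] i n by simp
  moreover have "(\<Sum>k<2 ^ (n + 1) - 1. f (projection_matrix (n - 1) $$ (i, k)) (left_mult_matrix n a $$ (k, j))) =
      (\<Sum>k<length (word_basis n). (\<lambda>x. if x = ?w then concat_coeff a x ?v else 0) (word_basis n ! k))"
    using assms
    by (intro sum.cong)
      (auto simp: index_projection_matrix index_left_mult_matrix length_word_basis simp del: One_nat_def)
  ultimately show ?thesis by (simp add: sum_word_basis[where f = "\<lambda>x. if x = ?w then concat_coeff a x ?v else 0"] del: One_nat_def)
qed

text \<open>Agrees with the value for the projection on the left, which is the desired commutation.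
  If the column word has length n, no index k matches it, but the coefficient is also 0 because that
  word is longer than the row word.\<close>

lemma sum_projection_right:
  assumes n: "1 \<le> n" and f: "\<And>y. f y 0 = 0" "\<And>y. f y 1 = y"
    and i: "i < 2 ^ n - 1" and j: "j < 2 ^ (n + 1) - 1"
  shows "(\<Sum>k<2 ^ n - 1. f (left_mult_matrix (n - 1) a $$ (i, k)) (projection_matrix (n - 1) $$ (k, j))) =
    concat_coeff a (word_basis (n - 1) ! i) (word_basis n ! j)"
proof -
  let ?w = "word_basis (n - 1) ! i" and ?v = "word_basis n ! j"
  have w: "length ?w \<le> n - 1" using length_nth_word_basis[of i "n - 1"] i n by simp
  have len: "length (word_basis (n - 1)) = 2 ^ n - 1" using n by (simp add: length_word_basis)
  have "(\<Sum>k<2 ^ n - 1. f (left_mult_matrix (n - 1) a $$ (i, k)) (projection_matrix (n - 1) $$ (k, j))) =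
      (\<Sum>k<length (word_basis (n - 1)). (\<lambda>x. if x = ?v then concat_coeff a ?w x else 0) (word_basis (n - 1) ! k))"
    using assms len
    by (intro sum.cong) (auto simp: index_projection_matrix index_left_mult_matrix simp del: One_nat_def)
  also have "\<dots> = (\<Sum>x | length x \<le> n - 1. if x = ?v then concat_coeff a ?w x else 0)"
    by (rule sum_word_basis)
  also have "\<dots> = concat_coeff a ?w ?v"
    using w by (cases "length ?v \<le> n - 1") (auto simp: concat_coeff_longer)
  finally show ?thesis .
qed

lemma projection_matrix_mult:
  fixes g :: "letter list \<Rightarrow> 'a::field"
  assumes "1 \<le> n"
  shows "projection_matrix (n - 1) * left_mult_matrix n g =
    left_mult_matrix (n - 1) g * projection_matrix (n - 1)"
proof -
  note P = carrier_matD[OF projection_matrix_carrier[OF assms, where ?'a = 'a]]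
  show ?thesis
    using sum_projection_left[OF assms, of "(*)" _ _ g] sum_projection_right[OF assms, of "(*)" _ _ g] P assms
    by (intro eq_matI) (simp_all add: scalar_prod_def atLeast0LessThan)
qed

lemma projection_matrix_form_mult:
  fixes C :: "('k, 'f::field, 'w::ab_group_add) curve"
  assumes "1 \<le> n" "\<And>\<omega>. smul C 0 \<omega> = 0" "\<And>\<omega>. smul C 1 \<omega> = \<omega>"
  shows "fun_form_mult C (projection_matrix (n - 1)) (left_mult_matrix n c) =
    form_fun_mult C (left_mult_matrix (n - 1) c) (projection_matrix (n - 1))"
proof -
  note P = carrier_matD[OF projection_matrix_carrier[OF assms(1), where ?'a = 'f]]
  show ?thesis
    using sum_projection_left[OF assms(1), of "smul C" _ _ c]
      sum_projection_right[OF assms(1), of "\<lambda>\<omega> g. smul C g \<omega>" _ _ c] P assms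
    by (intro eq_matI) (simp_all add: fun_form_mult_def form_fun_mult_def)
qed

section \<open>The function field and its differentials\<close>

text \<open>Serves two layers of the evaluation of bivariate polynomials: \<open>h\<close> is the
  map \<open>cst\<close> on the inner layer and the evaluation of the inner polynomials on the outer
  one. Both are plain functions, so their laws are hypotheses.\<close>

lemma poly_map_poly_add:
  fixes h :: "'a::comm_semiring_1 \<Rightarrow> 'b::comm_semiring_1"
  assumes "h 0 = 0" "\<And>a b. h (a + b) = h a + h b"
  shows "poly (map_poly h (p + q)) x = poly (map_poly h p) x + poly (map_poly h q) x"
proof -
  have "map_poly h (p + q) = map_poly h p + map_poly h q"
    using assms by (intro poly_eqI) (simp add: coeff_map_poly)
  then show ?thesis by simp
qed

lemma poly_map_poly_mult:
  fixes h :: "'a::comm_semiring_1 \<Rightarrow> 'b::comm_semiring_1"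
  assumes "h 0 = 0" "\<And>a b. h (a + b) = h a + h b" "\<And>a b. h (a * b) = h a * h b"
  shows "poly (map_poly h (p * q)) x = poly (map_poly h p) x * poly (map_poly h q) x"
proof (induction p)
  case (pCons a p)
  have "poly (map_poly h (Polynomial.smult a q)) x = h a * poly (map_poly h q) x"
    using assms by (simp add: map_poly_smult)
  then show ?case using pCons assms
    by (simp add: mult_pCons_left poly_map_poly_add map_poly_pCons algebra_simps)
qed simp

locale elliptic =
  fixes C :: "('k::field_char_0, 'f::field, 'w::ab_group_add) curve"
  assumes elliptic: "elliptic_curve C"
begin

lemma weierstrass: "weierstrass_model C" and kaehler: "kaehler_differentials C"
  using elliptic by (auto simp: elliptic_curve_def)

lemma cst_1 [simp]: "cst C 1 = 1"
  and cst_add: "cst C (a + b) = cst C a + cst C b"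
  and cst_mult: "cst C (a * b) = cst C a * cst C b"
  and degree_wpoly: "degree (wpoly C) = 3"
  and transcendental_xf: "poly (map_poly (cst C) p) (xf C) = 0 \<Longrightarrow> p = 0"
  and weierstrass_equation: "(yf C)\<^sup>2 = poly (map_poly (cst C) (wpoly C)) (xf C)"
  using weierstrass by (simp_all add: weierstrass_model_def)

lemma cst_0 [simp]: "cst C 0 = 0"
  by (metis add_0 add_cancel_right_right cst_add)

lemma cst_minus: "cst C (- a) = - cst C a"
  using cst_add[of a "- a"] by (simp add: eq_neg_iff_add_eq_0 add.commute)

lemma cst_inverse: "a \<noteq> 0 \<Longrightarrow> cst C a * cst C (inverse a) = 1"
  by (simp flip: cst_mult)

lemma cst_eq_0_iff [simp]: "cst C a = 0 \<longleftrightarrow> a = 0"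
  using cst_inverse[of a] by (cases "a = 0") auto

lemma cst_of_nat: "cst C (of_nat n) = of_nat n"
  by (induction n) (simp_all add: cst_add)

lemma xf_nonzero [simp]: "xf C \<noteq> 0"
  using transcendental_xf[of "[:0, 1:]"] by (auto simp: map_poly_pCons)

lemma yf_nonzero [simp]: "yf C \<noteq> 0"
  using weierstrass_equation transcendental_xf[of "wpoly C"] degree_wpoly by auto

sublocale forms: vector_space "smul C"
  using kaehler by (simp add: kaehler_differentials_def)

lemma dif_cst [simp]: "dif C (cst C a) = 0"
  and dif_add: "dif C (g + h) = dif C g + dif C h"
  and dif_mult: "dif C (g * h) = smul C g (dif C h) + smul C h (dif C g)"
proof -
  have "derivation_into (cst C) (smul C) (dif C)"
    using kaehler by (simp add: kaehler_differentials_def)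
  then show "dif C (cst C a) = 0" "dif C (g + h) = dif C g + dif C h"
    "dif C (g * h) = smul C g (dif C h) + smul C h (dif C g)"
    by (simp_all add: derivation_into_def)
qed

lemma dif_0 [simp]: "dif C 0 = 0" and dif_1 [simp]: "dif C 1 = 0"
  using dif_cst[of 0] dif_cst[of 1] by simp_all

lemma dif_minus: "dif C (- g) = - dif C g"
  using dif_add[of g "- g"] by (simp add: eq_neg_iff_add_eq_0 add.commute)

lemma dif_power: "dif C (g ^ Suc n) = smul C (of_nat (Suc n) * g ^ n) (dif C g)"
proof (induction n)
  case (Suc n)
  have "dif C (g ^ Suc (Suc n)) = smul C g (dif C (g ^ Suc n)) + smul C (g ^ Suc n) (dif C g)"
    by (subst power_Suc) (rule dif_mult)
  also have "\<dots> = smul C (g * (of_nat (Suc n) * g ^ n) + g ^ Suc n) (dif C g)"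
    by (simp only: Suc forms.scale_scale forms.scale_left_distrib)
  also have "g * (of_nat (Suc n) * g ^ n) + g ^ Suc n = of_nat (Suc (Suc n)) * g ^ Suc n"
    by (simp add: algebra_simps)
  finally show ?case .
qed simp

lemma dif_inverse: "g \<noteq> 0 \<Longrightarrow> dif C (inverse g) = smul C (- (inverse g)\<^sup>2) (dif C g)"
proof -
  assume g: "g \<noteq> 0"
  have "smul C g (dif C (inverse g)) = - smul C (inverse g) (dif C g)"
    using dif_mult[of g "inverse g"] g by (simp add: eq_neg_iff_add_eq_0)
  then have "smul C (inverse g) (smul C g (dif C (inverse g))) =
      smul C (inverse g) (- smul C (inverse g) (dif C g))" by simp
  then show ?thesis using g by (simp add: power2_eq_square)
qed

section \<open>Subalgebras, local rings and local forms\<close>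

definition subalgebra :: "'f set \<Rightarrow> bool" where
  "subalgebra R \<longleftrightarrow> range (cst C) \<subseteq> R \<and> (\<forall>a\<in>R. \<forall>b\<in>R. a + b \<in> R \<and> a * b \<in> R)"

lemma subalgebra_cst: "subalgebra R \<Longrightarrow> cst C a \<in> R"
  and subalgebra_add: "subalgebra R \<Longrightarrow> a' \<in> R \<Longrightarrow> b \<in> R \<Longrightarrow> a' + b \<in> R"
  and subalgebra_mult: "subalgebra R \<Longrightarrow> a' \<in> R \<Longrightarrow> b \<in> R \<Longrightarrow> a' * b \<in> R"
  by (auto simp: subalgebra_def)

lemma subalgebra_0: "subalgebra R \<Longrightarrow> 0 \<in> R" and subalgebra_1: "subalgebra R \<Longrightarrow> 1 \<in> R"
  using subalgebra_cst[of R 0] subalgebra_cst[of R 1] by simp_all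

lemma subalgebra_minus: "subalgebra R \<Longrightarrow> a \<in> R \<Longrightarrow> - a \<in> R"
  using subalgebra_mult[of R "cst C (- 1)" a] subalgebra_cst[of R "- 1"] by (simp add: cst_minus)

lemma subalgebra_diff: "subalgebra R \<Longrightarrow> a \<in> R \<Longrightarrow> b \<in> R \<Longrightarrow> a - b \<in> R"
  using subalgebra_add[of R a "- b"] subalgebra_minus by simp

lemma subalgebra_power: "subalgebra R \<Longrightarrow> a \<in> R \<Longrightarrow> a ^ n \<in> R"
  by (induction n) (auto intro: subalgebra_1 subalgebra_mult)

lemma subalgebra_poly:
  "subalgebra R \<Longrightarrow> a \<in> R \<Longrightarrow> poly (map_poly (cst C) p) a \<in> R"
  by (induction p) (auto simp: map_poly_pCons intro!: subalgebra_0 subalgebra_cst subalgebra_add subalgebra_mult)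

lemmas subalgebra_intros = subalgebra_cst subalgebra_0 subalgebra_1 subalgebra_add subalgebra_mult
  subalgebra_minus subalgebra_diff subalgebra_power

definition eval2 :: "'f \<Rightarrow> 'f \<Rightarrow> 'k poly poly \<Rightarrow> 'f" where
  "eval2 u v p = poly (map_poly (\<lambda>q. poly (map_poly (cst C) q) u) p) v"

lemma alg_gen_eq_range: "alg_gen C u v = range (eval2 u v)"
  by (simp add: alg_gen_def eval2_def)

lemma eval2_pCons: "eval2 u v (pCons q p) = poly (map_poly (cst C) q) u + v * eval2 u v p"
  by (simp add: eval2_def map_poly_pCons)

lemma eval2_0 [simp]: "eval2 u v 0 = 0"
  by (simp add: eval2_def)

lemma subalgebra_alg_gen: "subalgebra (alg_gen C u v)"
proof -
  have add: "eval2 u v p + eval2 u v q = eval2 u v (p + q)" for p q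
    unfolding eval2_def by (simp add: poly_map_poly_add cst_add)
  have mult: "eval2 u v p * eval2 u v q = eval2 u v (p * q)" for p q
    unfolding eval2_def
    by (rule poly_map_poly_mult[symmetric]) (simp_all add: poly_map_poly_add poly_map_poly_mult cst_add cst_mult)
  have "cst C a = eval2 u v [:[:a:]:]" for a by (simp add: eval2_pCons map_poly_pCons)
  then show ?thesis unfolding subalgebra_def alg_gen_eq_range using add mult by auto
qed

lemma alg_gen_generators: "u \<in> alg_gen C u v" "v \<in> alg_gen C u v"
proof -
  have "u = eval2 u v [:[:0, 1:]:]" "v = eval2 u v [:0, 1:]"
    by (simp_all add: eval2_pCons map_poly_pCons)
  then show "u \<in> alg_gen C u v" "v \<in> alg_gen C u v" unfolding alg_gen_eq_range by blast+
qed

lemma poly_cst_decomposition: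
  assumes "subalgebra R" "u \<in> R"
  shows "\<exists>a\<in>R. poly (map_poly (cst C) p) u = cst C (coeff p 0) + u * a"
  using assms subalgebra_poly subalgebra_0[OF assms(1)] by (cases p) (auto simp: map_poly_pCons)

text \<open>The constant term in v is a polynomial in u, whose own constant term is k. Applied to
  the chart at infinity, this makes K the residue field there.\<close>

lemma alg_gen_decomposition:
  assumes "a \<in> alg_gen C u v"
  obtains k b c where "b \<in> alg_gen C u v" "c \<in> alg_gen C u v" "a = cst C k + (u * b + v * c)"
proof -
  obtain p where p: "a = eval2 u v p" using assms by (auto simp: alg_gen_eq_range)
  obtain q p' where p': "p = pCons q p'" by (cases p)
  obtain b where b: "b \<in> alg_gen C u v" "poly (map_poly (cst C) q) u = cst C (coeff q 0) + u * b"
    using poly_cst_decomposition subalgebra_alg_gen alg_gen_generators by blast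
  have "eval2 u v p' \<in> alg_gen C u v" by (simp add: alg_gen_eq_range)
  then show thesis using that[of b "eval2 u v p'" "coeff q 0"] b by (simp add: p p' eval2_pCons)
qed

text \<open>Covers both kinds of points: at affine points M is a maximal ideal, at infinity an
  explicit ideal whose primality is shown by hand. Since 0 lies in M, denominators are
  nonzero.\<close>

lemma subalgebra_localization:
  assumes A: "subalgebra A" and M: "0 \<in> M" "1 \<notin> M"
    and prime: "\<And>a b. a \<in> A \<Longrightarrow> b \<in> A \<Longrightarrow> a \<notin> M \<Longrightarrow> b \<notin> M \<Longrightarrow> a * b \<notin> M"
  shows "subalgebra (localization A M)" and "A \<subseteq> localization A M"
proof -
  show sub: "A \<subseteq> localization A M"
  proof
    fix a assume "a \<in> A"
    moreover have "a = a / 1" by simp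
    ultimately show "a \<in> localization A M"
      unfolding localization_def using subalgebra_1[OF A] M(2) by blast
  qed
  have "g + h \<in> localization A M \<and> g * h \<in> localization A M"
    if gh: "g \<in> localization A M" "h \<in> localization A M" for g h
  proof -
    obtain a b where ab: "g = a / b" "a \<in> A" "b \<in> A" "b \<notin> M"
      using gh by (auto simp: localization_def)
    obtain c d where cd: "h = c / d" "c \<in> A" "d \<in> A" "d \<notin> M"
      using gh by (auto simp: localization_def)
    have "b \<noteq> 0" "d \<noteq> 0" using ab cd M by auto
    then have "g + h = (a * d + c * b) / (b * d)" by (simp add: ab cd field_simps)
    moreover have "g * h = (a * c) / (b * d)" by (simp add: ab cd)
    moreover have "a * d + c * b \<in> A" "a * c \<in> A" "b * d \<in> A" "b * d \<notin> M"
      using ab cd A prime by (auto intro: subalgebra_intros)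
    ultimately show ?thesis unfolding localization_def by blast
  qed
  then show "subalgebra (localization A M)"
    using sub subalgebra_cst[OF A] unfolding subalgebra_def by auto
qed

text \<open>Replaces sums of unspecified length by the addition of one term a db at a time.\<close>

lemma local_forms_induct [consumes 1, case_names zero step]:
  assumes "\<omega> \<in> local_forms C P" "Q 0"
    and step: "\<And>\<omega> a b. \<omega> \<in> local_forms C P \<Longrightarrow> Q \<omega> \<Longrightarrow> a \<in> local_ring C P \<Longrightarrow> b \<in> local_ring C P \<Longrightarrow>
      Q (\<omega> + smul C a (dif C b))"
  shows "Q \<omega>"
proof -
  obtain m :: nat and a b where \<omega>: "\<omega> = (\<Sum>i<m. smul C (a i) (dif C (b i)))"
    and ab: "\<forall>i<m. a i \<in> local_ring C P \<and> b i \<in> local_ring C P"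
    using assms(1) unfolding local_forms_def by blast
  have "Q (\<Sum>i<l. smul C (a i) (dif C (b i)))" if "l \<le> m" for l
    using that
  proof (induction l)
    case (Suc l)
    have "(\<Sum>i<l. smul C (a i) (dif C (b i))) \<in> local_forms C P"
      using ab Suc.prems unfolding local_forms_def by fastforce
    then show ?case using Suc ab step by simp
  qed (simp add: assms(2))
  then show ?thesis by (simp add: \<omega>)
qed

lemma zero_local_forms: "0 \<in> local_forms C P"
  unfolding local_forms_def by (rule CollectI, rule exI[of _ 0]) simp

lemma local_forms_step:
  assumes "\<omega> \<in> local_forms C P" "a \<in> local_ring C P" "b \<in> local_ring C P"
  shows "\<omega> + smul C a (dif C b) \<in> local_forms C P"
proof -
  obtain m :: nat and a' b' where \<omega>: "\<omega> = (\<Sum>i<m. smul C (a' i) (dif C (b' i)))"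
    and ab: "\<forall>i<m. a' i \<in> local_ring C P \<and> b' i \<in> local_ring C P"
    using assms(1) unfolding local_forms_def by blast
  have "\<omega> + smul C a (dif C b) = (\<Sum>i<Suc m. smul C ((a'(m := a)) i) (dif C ((b'(m := b)) i)))"
    by (simp add: \<omega>)
  moreover have "\<forall>i<Suc m. (a'(m := a)) i \<in> local_ring C P \<and> (b'(m := b)) i \<in> local_ring C P"
    using ab assms by (simp add: less_Suc_eq)
  ultimately show ?thesis unfolding local_forms_def by blast
qed

lemma local_forms_add:
  assumes "\<omega> \<in> local_forms C P" "\<eta> \<in> local_forms C P"
  shows "\<omega> + \<eta> \<in> local_forms C P"
  using assms(2)
  by (induction rule: local_forms_induct) (auto simp: assms(1) local_forms_step simp flip: add.assoc)

lemma local_forms_smul: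
  assumes "subalgebra (local_ring C P)" "\<omega> \<in> local_forms C P" "a \<in> local_ring C P"
  shows "smul C a \<omega> \<in> local_forms C P"
  using assms(2)
proof (induction rule: local_forms_induct)
  case (step \<omega> b c)
  then show ?case using local_forms_step[of "smul C a \<omega>" P "a * b" c] assms
    by (simp add: forms.scale_right_distrib subalgebra_mult)
qed (simp add: zero_local_forms)

lemma local_forms_dif:
  "subalgebra (local_ring C P) \<Longrightarrow> a \<in> local_ring C P \<Longrightarrow> dif C a \<in> local_forms C P"
  using local_forms_step[OF zero_local_forms, of 1 P a] subalgebra_1 by simp

lemma local_forms_minus:
  "subalgebra (local_ring C P) \<Longrightarrow> \<omega> \<in> local_forms C P \<Longrightarrow> - \<omega> \<in> local_forms C P"
  using local_forms_smul[of P \<omega> "- 1"] by (simp add: subalgebra_intros)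

section \<open>The point at infinity\<close>

abbreviation uniformizer :: 'f where
  "uniformizer \<equiv> xf C / yf C"

lemma infinity_ideal_cases:
  assumes "i \<in> infinity_ideal C"
  obtains a b where "a \<in> infinity_chart C" "b \<in> infinity_chart C" "i = uniformizer * a + 1 / yf C * b"
  using assms unfolding infinity_ideal_def by blast

lemma infinity_idealI:
  "a \<in> infinity_chart C \<Longrightarrow> b \<in> infinity_chart C \<Longrightarrow> uniformizer * a + 1 / yf C * b \<in> infinity_ideal C"
  unfolding infinity_ideal_def by blast

lemma infinity_chart_decomposition:
  assumes "a \<in> infinity_chart C"
  obtains k i where "i \<in> infinity_ideal C" "a = cst C k + i"
proof -
  obtain k b c where "b \<in> infinity_chart C" "c \<in> infinity_chart C"
    "a = cst C k + (uniformizer * b + 1 / yf C * c)"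
    by (rule alg_gen_decomposition[OF assms])
  then show thesis by (rule that[OF infinity_idealI])
qed

lemma infinity_ideal_chart:
  assumes "i \<in> infinity_ideal C"
  shows "i \<in> infinity_chart C"
proof -
  obtain a b where "a \<in> infinity_chart C" "b \<in> infinity_chart C" "i = uniformizer * a + 1 / yf C * b"
    by (rule infinity_ideal_cases[OF assms])
  then show ?thesis
    by (simp only: subalgebra_add[OF subalgebra_alg_gen] subalgebra_mult[OF subalgebra_alg_gen] alg_gen_generators)
qed

lemma infinity_ideal_add:
  assumes "i \<in> infinity_ideal C" "j \<in> infinity_ideal C"
  shows "i + j \<in> infinity_ideal C"
proof -
  obtain a b where ab: "a \<in> infinity_chart C" "b \<in> infinity_chart C" "i = uniformizer * a + 1 / yf C * b"
    by (rule infinity_ideal_cases[OF assms(1)])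
  obtain c d where cd: "c \<in> infinity_chart C" "d \<in> infinity_chart C" "j = uniformizer * c + 1 / yf C * d"
    by (rule infinity_ideal_cases[OF assms(2)])
  have "i + j = uniformizer * (a + c) + 1 / yf C * (b + d)"
    by (simp only: ab(3) cd(3) distrib_left add_ac)
  also have "\<dots> \<in> infinity_ideal C"
    using ab cd by (intro infinity_idealI subalgebra_add[OF subalgebra_alg_gen])
  finally show ?thesis .
qed

lemma infinity_ideal_mult:
  assumes "i \<in> infinity_ideal C" "c \<in> infinity_chart C"
  shows "i * c \<in> infinity_ideal C"
proof -
  obtain a b where ab: "a \<in> infinity_chart C" "b \<in> infinity_chart C" "i = uniformizer * a + 1 / yf C * b"
    by (rule infinity_ideal_cases[OF assms(1)])
  have "i * c = uniformizer * (a * c) + 1 / yf C * (b * c)"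
    by (simp only: ab(3) distrib_right mult.assoc)
  also have "\<dots> \<in> infinity_ideal C"
    using ab assms(2) by (intro infinity_idealI subalgebra_mult[OF subalgebra_alg_gen])
  finally show ?thesis .
qed

lemma cst_infinity_chart: "cst C k \<in> infinity_chart C"
  by (rule subalgebra_cst[OF subalgebra_alg_gen])

lemma infinity_ideal_cst: "i \<in> infinity_ideal C \<Longrightarrow> cst C k * i \<in> infinity_ideal C"
  using infinity_ideal_mult[of i "cst C k"] cst_infinity_chart by (simp add: mult.commute)

lemma infinity_ideal_minus: "i \<in> infinity_ideal C \<Longrightarrow> - i \<in> infinity_ideal C"
  using infinity_ideal_cst[of i "- 1"] by (simp add: cst_minus)

lemma infinity_ideal_diff:
  "i \<in> infinity_ideal C \<Longrightarrow> j \<in> infinity_ideal C \<Longrightarrow> i - j \<in> infinity_ideal C"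
  using infinity_ideal_add[of i "- j"] infinity_ideal_minus by simp

lemma infinity_ideal_generators: "uniformizer \<in> infinity_ideal C" "1 / yf C \<in> infinity_ideal C"
  using infinity_idealI[of 1 0] infinity_idealI[of 0 1]
    subalgebra_0[OF subalgebra_alg_gen] subalgebra_1[OF subalgebra_alg_gen] by simp_all

lemma zero_infinity_ideal: "0 \<in> infinity_ideal C"
  using infinity_ideal_diff[OF infinity_ideal_generators(1) infinity_ideal_generators(1)] by simp

lemma local_forms_empty_ring: "local_ring C P = {} \<Longrightarrow> local_forms C P = {0}"
proof (intro subset_antisym subsetI)
  fix \<omega> assume empty: "local_ring C P = {}" and "\<omega> \<in> local_forms C P"
  from this(2) show "\<omega> \<in> {0}" by (induction rule: local_forms_induct) (simp_all add: empty)
qed (simp add: zero_local_forms)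

text \<open>
  That \<open>\<infinity>\<close> lies on the curve need not be derived from the equation: if the ideal of \<open>\<infinity>\<close> were
  improper, the local ring would be the empty set and \<open>0\<close> the only local form.
\<close>

lemma infinity_ideal_proper_if_nonlogarithmic:
  assumes "pole_order_le C 2 \<omega>" "\<not> pole_order_le C 1 \<omega>"
  shows "1 \<notin> infinity_ideal C"
proof
  assume one: "1 \<in> infinity_ideal C"
  have "infinity_chart C \<subseteq> infinity_ideal C"
    using infinity_ideal_mult[OF one] by auto
  then have "local_ring C Infinity = {}" by (auto simp: localization_def)
  then have "smul C (uniformizer ^ 2) \<omega> = 0"
    using assms(1) local_forms_empty_ring by (simp only: pole_order_le_def) blast
  then have "\<omega> = 0" by simp
  then show False using assms(2) by (simp add: pole_order_le_def zero_local_forms)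
qed

section \<open>Affine points\<close>

text \<open>Gives access to the abstract fact that maximal ideals are prime.\<close>

lemma cring_affine_ring: "cring (ring_on (affine_ring C))"
proof -
  note A = subalgebra_alg_gen[of "xf C" "yf C"]
  show ?thesis
  proof (intro cringI abelian_groupI comm_monoidI)
    fix a assume "a \<in> carrier (ring_on (affine_ring C))"
    then have "- a \<in> carrier (ring_on (affine_ring C))" "- a + a = 0"
      using subalgebra_minus[OF A] by (auto simp: ring_on_def)
    then show "\<exists>b\<in>carrier (ring_on (affine_ring C)). b \<oplus>\<^bsub>ring_on (affine_ring C)\<^esub> a = \<zero>\<^bsub>ring_on (affine_ring C)\<^esub>"
      by (intro bexI[of _ "- a"]) (simp_all add: ring_on_def)
  qed (use A in \<open>auto simp: ring_on_def algebra_simps intro: subalgebra_intros\<close>)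
qed

lemma maximal_ideal_properties:
  assumes "maximalideal M (ring_on (affine_ring C))"
  shows "M \<subseteq> affine_ring C" "0 \<in> M" "1 \<notin> M"
    and "\<And>a b. a \<in> M \<Longrightarrow> b \<in> M \<Longrightarrow> a + b \<in> M"
    and "\<And>a b. a \<in> affine_ring C \<Longrightarrow> b \<in> M \<Longrightarrow> a * b \<in> M"
    and "\<And>a b. a \<in> affine_ring C \<Longrightarrow> b \<in> affine_ring C \<Longrightarrow> a \<notin> M \<Longrightarrow> b \<notin> M \<Longrightarrow> a * b \<notin> M"
proof -
  let ?A = "ring_on (affine_ring C)"
  interpret M: primeideal M ?A
    by (rule cring.maximalideal_prime[OF cring_affine_ring assms])
  have A: "carrier ?A = affine_ring C" by (simp add: ring_on_def)
  show sub: "M \<subseteq> affine_ring C" using M.a_subset A by simp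
  show "0 \<in> M" using additive_subgroup.zero_closed[OF M.is_additive_subgroup] by (simp add: ring_on_def)
  show "a + b \<in> M" if "a \<in> M" "b \<in> M" for a b
    using additive_subgroup.a_closed[OF M.is_additive_subgroup that] by (simp add: ring_on_def)
  show mult: "a * b \<in> M" if "a \<in> affine_ring C" "b \<in> M" for a b
    using M.I_l_closed[of b a] that by (simp add: ring_on_def)
  show "a * b \<notin> M" if "a \<in> affine_ring C" "b \<in> affine_ring C" "a \<notin> M" "b \<notin> M" for a b
    using M.I_prime[of a b] that by (auto simp: ring_on_def)
  show "1 \<notin> M"
  proof
    assume "1 \<in> M"
    then have "affine_ring C \<subseteq> M" using mult[of _ 1] by auto
    then show False using sub M.I_notcarr A by auto
  qed
qed

lemma subalgebra_affine_point:
  assumes "maximalideal M (ring_on (affine_ring C))"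
  shows "subalgebra (local_ring C (Affine M))" "affine_ring C \<subseteq> local_ring C (Affine M)"
  using subalgebra_localization[OF subalgebra_alg_gen maximal_ideal_properties(2,3,6)[OF assms]]
  by simp_all

text \<open>Induction on the degree in y: multiplying by y turns l y into l y^2, and y^2 = f(0) + x
  w brings this back to the form k + l y modulo x.\<close>

lemma affine_ring_decomposition:
  assumes "a \<in> affine_ring C"
  shows "\<exists>k l. \<exists>b\<in>affine_ring C. a = cst C k + cst C l * yf C + xf C * b"
proof -
  let ?A = "affine_ring C"
  note A = subalgebra_alg_gen[of "xf C" "yf C"] and gens = alg_gen_generators[where u = "xf C" and v = "yf C"]
  obtain w where w: "w \<in> ?A" "(yf C)\<^sup>2 = cst C (coeff (wpoly C) 0) + xf C * w"
    unfolding weierstrass_equation using poly_cst_decomposition[OF A gens(1)] by blast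
  have "\<exists>k l. \<exists>b\<in>?A. eval2 (xf C) (yf C) p = cst C k + cst C l * yf C + xf C * b" for p
  proof (induction p)
    case 0
    show ?case by (intro exI[of _ 0] bexI[of _ 0]) (simp_all add: subalgebra_0[OF A])
  next
    case (pCons q p)
    obtain k l b where b: "b \<in> ?A" "eval2 (xf C) (yf C) p = cst C k + cst C l * yf C + xf C * b"
      using pCons by blast
    obtain c where c: "c \<in> ?A" "poly (map_poly (cst C) q) (xf C) = cst C (coeff q 0) + xf C * c"
      using poly_cst_decomposition[OF A gens(1)] by blast
    have "eval2 (xf C) (yf C) (pCons q p) =
        cst C (coeff q 0) + xf C * c + (cst C k * yf C + cst C l * (yf C)\<^sup>2 + xf C * (b * yf C))"
      by (simp add: eval2_pCons b(2) c(2) power2_eq_square algebra_simps)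
    also have "\<dots> = cst C (coeff q 0 + l * coeff (wpoly C) 0) + cst C k * yf C +
        xf C * (c + cst C l * w + b * yf C)"
      by (simp add: w(2) cst_add cst_mult algebra_simps)
    finally have "eval2 (xf C) (yf C) (pCons q p) = cst C (coeff q 0 + l * coeff (wpoly C) 0) +
        cst C k * yf C + xf C * (c + cst C l * w + b * yf C)" .
    moreover have "c + cst C l * w + b * yf C \<in> ?A"
      by (intro subalgebra_add[OF A] subalgebra_mult[OF A] subalgebra_cst[OF A] b(1) c(1) w(1) gens(2))
    ultimately show ?case by blast
  qed
  then show ?thesis using assms by (auto simp: alg_gen_eq_range)
qed

text \<open>
  Modulo \<open>x\<close> every element of \<open>K[x, y]\<close> is of the form \<open>k + ly\<close>, so a maximal ideal containing
  \<open>x\<close> is determined by the pairs \<open>(k, l)\<close> with \<open>k + ly\<close> in it. These are all multiples of some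
  \<open>(-e, 1)\<close> with \<open>e\<^sup>2 = f(0)\<close>, or only \<open>(0, 0)\<close>.
\<close>

lemma finite_maximal_ideals_over_xf:
  "finite {M. maximalideal M (ring_on (affine_ring C)) \<and> xf C \<in> M}"
proof -
  let ?A = "affine_ring C"
  note A = subalgebra_alg_gen[of "xf C" "yf C"] and gens = alg_gen_generators[where u = "xf C" and v = "yf C"]
  \<comment> \<open>\<open>\<Phi>\<close> recovers an ideal containing x from its set of pairs (k,
    l), so it suffices to bound the possible sets of pairs. \<open>L e\<close> consists of the pairs
    for which k + l y vanishes at y = e.\<close>
  define \<Phi> where "\<Phi> S = {cst C k + cst C l * yf C + xf C * b | k l b. (k, l) \<in> S \<and> b \<in> ?A}" for S
  define L where "L e = {(k, l). k + l * e = 0}" for e :: 'k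
  define f0 where "f0 = coeff (wpoly C) 0"
  obtain w where w: "w \<in> ?A" "(yf C)\<^sup>2 = cst C f0 + xf C * w"
    unfolding weierstrass_equation f0_def using poly_cst_decomposition[OF A gens(1)] by blast
  have roots: "finite {e. e\<^sup>2 = f0}"
  proof (cases "\<exists>e. e\<^sup>2 = f0")
    case True
    then obtain e where e: "e\<^sup>2 = f0" ..
    then have "{e. e\<^sup>2 = f0} \<subseteq> {e, - e}" by (auto simp: power2_eq_iff)
    then show ?thesis by (rule finite_subset) simp
  qed simp
  have "M \<in> \<Phi> ` insert {(0, 0)} (L ` {e. e\<^sup>2 = f0})"
    if M: "maximalideal M (ring_on ?A)" "xf C \<in> M" for M
  proof -
    note props = maximal_ideal_properties[OF M(1)]
    have M_diff: "a - b \<in> M" if "a \<in> M" "b \<in> M" for a b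
      using props(4)[OF that(1) props(5)[OF subalgebra_cst[OF A, of "- 1"] that(2)]]
      by (simp add: cst_minus)
    have M_x: "xf C * b \<in> M" if "b \<in> ?A" for b
      using props(5)[OF that M(2)] by (simp add: mult.commute)
    have M_cst: "k = 0" if "cst C k \<in> M" for k
      using props(5)[OF subalgebra_cst[OF A, of "inverse k"] that] props(3) cst_inverse[of k]
      by (cases "k = 0") (auto simp: mult.commute)
    define S where "S = {(k, l). cst C k + cst C l * yf C \<in> M}"
    have "M = \<Phi> S"
    proof (intro subset_antisym subsetI)
      fix a assume a: "a \<in> M"
      then obtain k l b where b: "b \<in> ?A" "a = cst C k + cst C l * yf C + xf C * b"
        using affine_ring_decomposition props(1) by blast
      have "cst C k + cst C l * yf C = a - xf C * b" by (simp add: b(2))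
      then have "cst C k + cst C l * yf C \<in> M" using M_diff[OF a M_x[OF b(1)]] by simp
      then show "a \<in> \<Phi> S" unfolding \<Phi>_def S_def using b by blast
    next
      fix a assume "a \<in> \<Phi> S"
      then obtain k l b where "a = cst C k + cst C l * yf C + xf C * b"
        "cst C k + cst C l * yf C \<in> M" "b \<in> ?A"
        unfolding \<Phi>_def S_def by blast
      then show "a \<in> M" using props(4) M_x by blast
    qed
    moreover have "S \<in> insert {(0, 0)} (L ` {e. e\<^sup>2 = f0})"
    proof (cases "\<forall>(k, l)\<in>S. l = 0")
      \<comment> \<open>The case in which y is not congruent to a constant modulo M, that is, the
        residue field is larger than K.\<close>
      case True
      have "(0, 0) \<in> S" using props(2) by (simp add: S_def)
      moreover have "kl = (0, 0)" if "kl \<in> S" for kl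
      proof -
        obtain k l where kl: "kl = (k, l)" by (cases kl)
        have "l = 0" using True that kl by blast
        then have "cst C k \<in> M" using that by (simp add: kl S_def)
        then show ?thesis using M_cst \<open>l = 0\<close> kl by blast
      qed
      ultimately have "S = {(0, 0)}" by blast
      then show ?thesis by simp
    next
      case False
      then obtain k l where kl: "cst C k + cst C l * yf C \<in> M" "l \<noteq> 0"
        by (auto simp: S_def)
      \<comment> \<open>Dividing k + l y by l shows that y is congruent to this constant modulo
        M.\<close>
      define e where "e = - k / l"
      have "yf C - cst C e = cst C (inverse l) * (cst C k + cst C l * yf C)"
      proof -
        have "e = - (inverse l * k)" by (simp add: e_def field_simps)
        then have "cst C e = - (cst C (inverse l) * cst C k)" by (simp add: cst_minus cst_mult)
        moreover have "cst C (inverse l) * (cst C l * yf C) = yf C"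
          using cst_inverse[OF kl(2)] by (metis mult.assoc mult.commute mult_1_left)
        ultimately show ?thesis by (simp only: distrib_left) simp
      qed
      then have ye: "yf C - cst C e \<in> M"
        using props(5)[OF subalgebra_cst[OF A] kl(1)] by simp
      have iff: "cst C k + cst C l * yf C \<in> M \<longleftrightarrow> k + l * e = 0" for k l
      proof -
        have eq: "cst C k + cst C l * yf C = cst C (k + l * e) + cst C l * (yf C - cst C e)"
          by (simp add: cst_add cst_mult algebra_simps)
        have ly: "cst C l * (yf C - cst C e) \<in> M"
          by (rule props(5)[OF subalgebra_cst[OF A] ye])
        show ?thesis
        proof
          assume "cst C k + cst C l * yf C \<in> M"
          from M_diff[OF this ly] have "cst C (k + l * e) \<in> M"
            unfolding eq by (simp only: add_diff_cancel_right')
          then show "k + l * e = 0" by (rule M_cst)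
        next
          assume "k + l * e = 0"
          then show "cst C k + cst C l * yf C \<in> M" unfolding eq using ly by (simp only: cst_0 add_0_left)
        qed
      qed
      \<comment> \<open>Modulo M, y^2 is e^2 because of y - e and f(0) because of x. Hence M
        contains the constant e^2 - f(0), which must be 0.\<close>
      have "(yf C + cst C e) * (yf C - cst C e) \<in> M"
        by (rule props(5)[OF subalgebra_add[OF A gens(2) subalgebra_cst[OF A]] ye])
      from M_diff[OF M_x[OF w(1)] this]
      have "xf C * w - (yf C + cst C e) * (yf C - cst C e) \<in> M" .
      moreover have "xf C * w - (yf C + cst C e) * (yf C - cst C e) = cst C (e\<^sup>2 - f0)"
      proof -
        have "cst C (e\<^sup>2 - f0) = (cst C e)\<^sup>2 - cst C f0"
          using cst_add[of "e\<^sup>2" "- f0"] by (simp add: power2_eq_square cst_mult cst_minus)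
        moreover have "(yf C + cst C e) * (yf C - cst C e) = (yf C)\<^sup>2 - (cst C e)\<^sup>2"
          by (simp add: power2_eq_square algebra_simps)
        ultimately show ?thesis by (simp add: w(2))
      qed
      ultimately have "cst C (e\<^sup>2 - f0) \<in> M" by (simp only:)
      then have "e\<^sup>2 = f0" using M_cst[of "e\<^sup>2 - f0"] by simp
      moreover have "S = L e" by (simp only: S_def L_def iff)
      ultimately show ?thesis by blast
    qed
    ultimately show ?thesis by blast
  qed
  then have "{M. maximalideal M (ring_on ?A) \<and> xf C \<in> M} \<subseteq> \<Phi> ` insert {(0, 0)} (L ` {e. e\<^sup>2 = f0})"
    by blast
  then show ?thesis by (rule finite_subset) (simp add: roots)
qed

end

section \<open>Lowering pole orders at infinity\<close>

text \<open>Properness of the ideal of infinity is assumed here and discharged once a form with a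
  pole of exact order 2 is at hand.\<close>

locale elliptic_infinity = elliptic C
  for C :: "('k::field_char_0, 'f::field, 'w::ab_group_add) curve" +
  assumes infinity_ideal_proper: "1 \<notin> infinity_ideal C"
begin

lemma cst_notin_infinity_ideal:
  assumes "k \<noteq> 0"
  shows "cst C k \<notin> infinity_ideal C"
proof
  assume "cst C k \<in> infinity_ideal C"
  then have "cst C k * cst C (inverse k) \<in> infinity_ideal C"
    by (rule infinity_ideal_mult) (rule cst_infinity_chart)
  then show False using infinity_ideal_proper cst_inverse[OF assms] by simp
qed

lemma infinity_unit_decomposition:
  assumes "a \<in> infinity_chart C" "a \<notin> infinity_ideal C"
  obtains k i where "k \<noteq> 0" "i \<in> infinity_ideal C" "a = cst C k + i"
proof -
  obtain k i where ki: "i \<in> infinity_ideal C" "a = cst C k + i"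
    by (rule infinity_chart_decomposition[OF assms(1)])
  have "k \<noteq> 0"
  proof
    assume "k = 0"
    then show False using ki assms(2) by simp
  qed
  then show thesis using ki by (rule that)
qed

text \<open>Elements of the chart are constants modulo the ideal, those outside it have nonzero
  constants, and constants multiply.\<close>

lemma infinity_ideal_prime:
  assumes "a \<in> infinity_chart C" "b \<in> infinity_chart C"
    "a \<notin> infinity_ideal C" "b \<notin> infinity_ideal C"
  shows "a * b \<notin> infinity_ideal C"
proof
  assume ab: "a * b \<in> infinity_ideal C"
  obtain k i where k: "k \<noteq> 0" "i \<in> infinity_ideal C" "a = cst C k + i"
    by (rule infinity_unit_decomposition[OF assms(1,3)])
  obtain l j where l: "l \<noteq> 0" "j \<in> infinity_ideal C" "b = cst C l + j"
    by (rule infinity_unit_decomposition[OF assms(2,4)])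
  have "cst C (k * l) = a * b - (i * b + cst C k * j)"
    by (simp add: k(3) l(3) cst_mult algebra_simps)
  also have "\<dots> \<in> infinity_ideal C"
    using infinity_ideal_add[OF infinity_ideal_mult[OF k(2) assms(2)] infinity_ideal_cst[OF l(2)]]
    by (rule infinity_ideal_diff[OF ab])
  finally show False using cst_notin_infinity_ideal[of "k * l"] k(1) l(1) by simp
qed

lemma subalgebra_infinity: "subalgebra (local_ring C Infinity)"
  and infinity_chart_subset: "infinity_chart C \<subseteq> local_ring C Infinity"
  using subalgebra_localization[OF subalgebra_alg_gen zero_infinity_ideal infinity_ideal_proper infinity_ideal_prime]
  by simp_all

lemma infinity_unit_inverse:
  "a \<in> infinity_chart C \<Longrightarrow> a \<notin> infinity_ideal C \<Longrightarrow> 1 / a \<in> local_ring C Infinity"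
  using subalgebra_1[OF subalgebra_alg_gen] by (auto simp: localization_def)

lemma uniformizer_infinity: "uniformizer \<in> local_ring C Infinity"
  using infinity_chart_subset alg_gen_generators by blast

text \<open>
  With \<open>t = x/y\<close> and \<open>s = 1/y\<close>, dividing \<open>y\<^sup>2 = ax\<^sup>3 + bx\<^sup>2 + cx + d\<close> by \<open>y\<^sup>2\<close> gives
  \<open>at\<^sup>2x = 1 - bt\<^sup>2 - cts - ds\<^sup>2\<close>, which is a unit at \<open>\<infinity>\<close>.
\<close>

lemma inverse_xf_infinity: "1 / xf C \<in> local_ring C Infinity"
proof -
  define a b c d where "a = cst C (coeff (wpoly C) 3)" and "b = cst C (coeff (wpoly C) 2)"
    and "c = cst C (coeff (wpoly C) 1)" and "d = cst C (coeff (wpoly C) 0)"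
  have deg: "degree (map_poly (cst C) (wpoly C)) = 3"
    by (simp add: degree_map_poly degree_wpoly)
  have eq: "(yf C)\<^sup>2 = d + c * xf C + b * (xf C)\<^sup>2 + a * xf C ^ 3"
    unfolding weierstrass_equation poly_altdef deg
    by (simp add: coeff_map_poly a_def b_def c_def d_def numeral_3_eq_3 numeral_2_eq_2)
  define t s where "t = uniformizer" and "s = 1 / yf C"
  have ideal: "t \<in> infinity_ideal C" "s \<in> infinity_ideal C"
    and chart: "t \<in> infinity_chart C" "s \<in> infinity_chart C"
    using infinity_ideal_generators alg_gen_generators by (auto simp: t_def s_def)
  define q where "q = b * (t * t) + c * (t * s) + d * (s * s)"
  have q: "q \<in> infinity_ideal C"
    unfolding q_def b_def c_def d_def using ideal chart
    by (intro infinity_ideal_add infinity_ideal_cst infinity_ideal_mult)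
  have D: "1 - q \<in> infinity_chart C" "1 - q \<notin> infinity_ideal C"
    using infinity_ideal_chart[OF q] infinity_ideal_add[OF _ q, of "1 - q"] infinity_ideal_proper
      subalgebra_1[OF subalgebra_alg_gen] subalgebra_diff[OF subalgebra_alg_gen] by auto
  then have "1 - q \<noteq> 0" using zero_infinity_ideal by auto
  have "1 - q = (yf C)\<^sup>2 / (yf C)\<^sup>2 - (d + c * xf C + b * (xf C)\<^sup>2) / (yf C)\<^sup>2"
    by (simp add: q_def t_def s_def power2_eq_square add_divide_distrib)
  also have "\<dots> = a * xf C ^ 3 / (yf C)\<^sup>2"
    by (subst (1) eq) (simp add: diff_divide_distrib[symmetric])
  also have "\<dots> = a * (t * t) * xf C"
    by (simp add: t_def power2_eq_square power3_eq_cube)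
  finally have e: "1 - q = a * (t * t) * xf C" .
  have "1 / xf C = a * (t * t) / (1 - q)"
    using \<open>1 - q \<noteq> 0\<close> by (simp add: e)
  also have "\<dots> = a * (t * t) * (1 / (1 - q))" by simp
  also have "\<dots> \<in> local_ring C Infinity"
    unfolding a_def t_def using infinity_unit_inverse[OF D] uniformizer_infinity
    by (intro subalgebra_mult[OF subalgebra_infinity] subalgebra_cst[OF subalgebra_infinity])
  finally show ?thesis .
qed

text \<open>The second generator 1/y equals t * (1/x), and 1/x is regular at infinity, so t alone
  generates in the local ring.\<close>

lemma infinity_ideal_uniformizer:
  assumes "i \<in> infinity_ideal C"
  obtains h where "h \<in> local_ring C Infinity" "i = uniformizer * h"
proof -
  obtain a b where ab: "a \<in> infinity_chart C" "b \<in> infinity_chart C" "i = uniformizer * a + 1 / yf C * b"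
    by (rule infinity_ideal_cases[OF assms])
  have "i = uniformizer * (a + 1 / xf C * b)" by (simp add: ab(3) field_simps)
  moreover have "a + 1 / xf C * b \<in> local_ring C Infinity"
    using ab infinity_chart_subset inverse_xf_infinity subalgebra_infinity
    by (intro subalgebra_add subalgebra_mult) auto
  ultimately show thesis using that by blast
qed

text \<open>For h = p/q with p = l + j and q = k + i, the difference h - l/k = (k j - l i)/(k q) has
  its numerator in the ideal, hence divisible by t.\<close>

lemma local_ring_infinity_decomposition:
  assumes "h \<in> local_ring C Infinity"
  obtains k h' where "h' \<in> local_ring C Infinity" "h = cst C k + uniformizer * h'"
proof -
  obtain p q where pq: "h = p / q" "p \<in> infinity_chart C" "q \<in> infinity_chart C" "q \<notin> infinity_ideal C"
    using assms by (auto simp: localization_def)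
  obtain k i where k: "k \<noteq> 0" "i \<in> infinity_ideal C" "q = cst C k + i"
    by (rule infinity_unit_decomposition[OF pq(3,4)])
  obtain l j where l: "j \<in> infinity_ideal C" "p = cst C l + j"
    by (rule infinity_chart_decomposition[OF pq(2)])
  have "cst C k * j - cst C l * i \<in> infinity_ideal C"
    using k l by (intro infinity_ideal_diff infinity_ideal_cst)
  then obtain m where m: "m \<in> local_ring C Infinity" "cst C k * j - cst C l * i = uniformizer * m"
    by (rule infinity_ideal_uniformizer)
  define u where "u = 1 / (cst C k * q)"
  have "u \<in> local_ring C Infinity" unfolding u_def
    using pq k cst_notin_infinity_ideal
    by (intro infinity_unit_inverse infinity_ideal_prime subalgebra_mult[OF subalgebra_alg_gen] cst_infinity_chart)
  then have "m * u \<in> local_ring C Infinity" using m subalgebra_infinity by (intro subalgebra_mult)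
  moreover have "h = cst C (l / k) + uniformizer * (m * u)"
  proof -
    have "q \<noteq> 0" using pq zero_infinity_ideal by auto
    have "cst C (l / k) * cst C k = cst C l" using k by (simp flip: cst_mult)
    then have lk: "cst C (l / k) = cst C l / cst C k" using k by (simp add: field_simps)
    have "uniformizer * (m * u) = (cst C k * j - cst C l * i) * u" by (simp only: m(2) mult.assoc)
    also have "\<dots> = (cst C k * p - cst C l * q) * u" by (simp add: k(3) l(2) algebra_simps)
    also have "\<dots> = h - cst C (l / k)"
      using \<open>q \<noteq> 0\<close> k(1) by (simp add: u_def pq(1) lk field_simps)
    finally show ?thesis by simp
  qed
  ultimately show thesis by (rule that)
qed

text \<open>For a term a db with b = k1 + t b' one has db = b' dt + t db'. Modulo t only the
  constant terms of a and b' count, and they lie in K. This is why b is expanded twice and a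
  once.\<close>

lemma local_forms_infinity_decomposition:
  assumes "\<omega> \<in> local_forms C Infinity"
  shows "\<exists>k. \<exists>\<eta>\<in>local_forms C Infinity.
    \<omega> = smul C (cst C k) (dif C uniformizer) + smul C uniformizer \<eta>"
  using assms
proof (induction rule: local_forms_induct)
  case zero
  show ?case by (rule exI[of _ 0]) (use zero_local_forms in auto)
next
  case (step \<omega> a b)
  let ?t = uniformizer and ?O = "local_ring C Infinity" and ?L = "local_forms C Infinity"
  obtain k \<eta> where \<eta>: "\<eta> \<in> ?L" "\<omega> = smul C (cst C k) (dif C ?t) + smul C ?t \<eta>"
    using step by blast
  have ab: "a \<in> ?O" "b \<in> ?O" using step by blast+
  obtain k1 b' where b: "b' \<in> ?O" "b = cst C k1 + ?t * b'"
    by (rule local_ring_infinity_decomposition[OF ab(2)])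
  obtain k2 b'' where b': "b'' \<in> ?O" "b' = cst C k2 + ?t * b''"
    by (rule local_ring_infinity_decomposition[OF b(1)])
  obtain k3 a' where a: "a' \<in> ?O" "a = cst C k3 + ?t * a'"
    by (rule local_ring_infinity_decomposition[OF ab(1)])
  define \<theta> where "\<theta> = smul C b'' (dif C ?t) + dif C b'"
  have \<theta>: "\<theta> \<in> ?L"
    unfolding \<theta>_def using b b' uniformizer_infinity subalgebra_infinity
    by (intro local_forms_add local_forms_smul local_forms_dif)
  have "dif C b = smul C ?t (dif C b') + smul C b' (dif C ?t)"
    by (simp only: b(2) dif_add dif_mult dif_cst add_0_left)
  also have "smul C b' (dif C ?t) = smul C (cst C k2) (dif C ?t) + smul C ?t (smul C b'' (dif C ?t))"
    by (simp only: b'(2) forms.scale_left_distrib forms.scale_scale)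
  finally have db: "dif C b = smul C (cst C k2) (dif C ?t) + smul C ?t \<theta>"
    by (simp only: \<theta>_def forms.scale_right_distrib add_ac)
  define \<eta>' where "\<eta>' = \<eta> + (smul C (a' * cst C k2) (dif C ?t) + smul C a \<theta>)"
  have "\<eta>' \<in> ?L"
    unfolding \<eta>'_def using \<eta> \<theta> a step uniformizer_infinity subalgebra_infinity
    by (intro local_forms_add local_forms_smul local_forms_dif subalgebra_mult subalgebra_cst)
  moreover have "\<omega> + smul C a (dif C b) = smul C (cst C (k + k3 * k2)) (dif C ?t) + smul C ?t \<eta>'"
  proof -
    have "smul C a (dif C b) = smul C (a * cst C k2) (dif C ?t) + smul C (a * ?t) \<theta>"
      by (simp add: db forms.scale_right_distrib)
    also have "smul C (a * cst C k2) (dif C ?t) =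
        smul C (cst C (k3 * k2)) (dif C ?t) + smul C ?t (smul C (a' * cst C k2) (dif C ?t))"
      by (simp add: a(2) cst_mult algebra_simps forms.scale_left_distrib)
    finally show ?thesis
      by (simp add: \<eta>(2) \<eta>'_def cst_add forms.scale_left_distrib forms.scale_right_distrib mult.commute add_ac)
  qed
  ultimately show ?case by blast
qed

lemma uniformizer_power_infinity: "uniformizer ^ n \<in> local_ring C Infinity"
  by (rule subalgebra_power[OF subalgebra_infinity uniformizer_infinity])

lemma smul_uniformizer_power:
  "\<omega> \<in> local_forms C Infinity \<Longrightarrow> smul C (uniformizer ^ n) \<omega> \<in> local_forms C Infinity"
  by (rule local_forms_smul[OF subalgebra_infinity _ uniformizer_power_infinity])

lemma pole_order_le_mono:
  assumes "pole_order_le C m \<omega>" "m \<le> n"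
  shows "pole_order_le C n \<omega>"
  using smul_uniformizer_power[of "smul C (uniformizer ^ m) \<omega>" "n - m"] assms
  by (simp add: pole_order_le_def flip: power_add)

lemma pole_order_le_add:
  assumes "pole_order_le C m \<omega>" "pole_order_le C n \<eta>"
  shows "pole_order_le C (max m n) (\<omega> + \<eta>)"
  using pole_order_le_mono[OF assms(1), of "max m n"] pole_order_le_mono[OF assms(2), of "max m n"]
  by (simp add: pole_order_le_def forms.scale_right_distrib local_forms_add)

abbreviation pole_fun :: 'f where
  "pole_fun \<equiv> inverse uniformizer"

lemma pole_order_reduction:
  assumes "pole_order_le C (Suc (Suc m)) \<omega>"
  shows "\<exists>k. pole_order_le C (Suc m) (\<omega> - dif C (cst C k * pole_fun ^ Suc m))"
proof -
  define t where "t = uniformizer"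
  have t: "t \<noteq> 0" by (simp add: t_def)
  obtain k \<eta> where \<eta>: "\<eta> \<in> local_forms C Infinity"
    "smul C (t ^ Suc (Suc m)) \<omega> = smul C (cst C k) (dif C t) + smul C t \<eta>"
    using local_forms_infinity_decomposition assms unfolding pole_order_le_def t_def by blast
  \<comment> \<open>Chosen so that d(c t^(-m-1)) = -c (m+1) t^(-m-2) dt equals k t^(-m-2) dt, the
    leading term of the form.\<close>
  define c where "c = - k / of_nat (Suc m)"
  have c: "c * of_nat (Suc m) = - k" unfolding c_def
    by (rule nonzero_eq_divide_eq[THEN iffD1]) (simp_all del: of_nat_Suc)
  have "smul C (inverse t) (smul C (t ^ Suc (Suc m)) \<omega>) =
      smul C (inverse t) (smul C (cst C k) (dif C t) + smul C t \<eta>)"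
    by (simp only: \<eta>(2))
  then have \<omega>: "smul C (t ^ Suc m) \<omega> = smul C (inverse t * cst C k) (dif C t) + \<eta>"
    using t by (simp add: forms.scale_right_distrib flip: mult.assoc)
  have "dif C (cst C c * inverse t ^ Suc m) =
      smul C (cst C c * (of_nat (Suc m) * inverse t ^ m) * - (inverse t)\<^sup>2) (dif C t)"
    by (simp only: dif_mult dif_cst dif_power dif_inverse[OF t] forms.scale_scale
        forms.scale_zero_right add_0_right mult.assoc)
  also have "cst C c * (of_nat (Suc m) * inverse t ^ m) * - (inverse t)\<^sup>2 =
      - (cst C (c * of_nat (Suc m))) * (inverse t ^ m * (inverse t)\<^sup>2)"
    by (simp only: cst_mult cst_of_nat mult_ac mult_minus_left mult_minus_right)
  also have "\<dots> = cst C k * (inverse t ^ m * (inverse t)\<^sup>2)"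
    by (simp only: c cst_minus minus_minus)
  finally have "smul C (t ^ Suc m) (dif C (cst C c * inverse t ^ Suc m)) =
      smul C (t ^ Suc m * (cst C k * (inverse t ^ m * (inverse t)\<^sup>2))) (dif C t)"
    by (simp only: forms.scale_scale)
  also have "t ^ Suc m * (cst C k * (inverse t ^ m * (inverse t)\<^sup>2)) = inverse t * cst C k"
    using t by (simp add: power2_eq_square field_simps)
  finally have "smul C (t ^ Suc m) (\<omega> - dif C (cst C c * inverse t ^ Suc m)) = \<eta>"
    by (simp only: forms.scale_right_diff_distrib \<omega> add_diff_cancel_left')
  then show ?thesis using \<eta>(1) unfolding pole_order_le_def t_def by metis
qed

section \<open>The gauge transformation\<close>

text \<open>This set is X \<inter> Y; Y itself arises by adding \<open>Infinity\<close>.\<close>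

definition affine_overlap :: "'f point set" where
  "affine_overlap = Affine ` {M. maximalideal M (ring_on (affine_ring C)) \<and> xf C \<notin> M}"

lemma affine_overlap_subset: "affine_overlap \<subseteq> affine_points C"
  by (auto simp: affine_overlap_def affine_points_def)

lemma overlap_Int: "insert Infinity affine_overlap \<inter> affine_points C = affine_overlap"
  using affine_overlap_subset by (auto simp: affine_points_def)

lemma overlap_Diff: "insert Infinity affine_overlap - {Infinity} = affine_overlap"
  by (auto simp: affine_overlap_def)

lemma zariski_open_overlap: "zariski_open C (insert Infinity affine_overlap)"
proof -
  have "points C - insert Infinity affine_overlap \<subseteq>
      Affine ` {M. maximalideal M (ring_on (affine_ring C)) \<and> xf C \<in> M}"
    by (auto simp: points_def affine_points_def affine_overlap_def)
  then have "finite (points C - insert Infinity affine_overlap)"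
    by (rule finite_subset) (simp add: finite_maximal_ideals_over_xf)
  then show ?thesis
    using affine_overlap_subset by (auto simp: zariski_open_def points_def)
qed

lemma subalgebra_overlap: "P \<in> affine_overlap \<Longrightarrow> subalgebra (local_ring C P)"
  using subalgebra_affine_point by (auto simp: affine_overlap_def simp del: local_ring.simps)

lemma pole_fun_overlap:
  assumes "P \<in> affine_overlap"
  shows "pole_fun \<in> local_ring C P"
proof -
  obtain M where M: "P = Affine M" "xf C \<notin> M" using assms by (auto simp: affine_overlap_def)
  have "pole_fun = yf C / xf C" by simp
  then show ?thesis
    using M alg_gen_generators[where u = "xf C" and v = "yf C"]
    unfolding M local_ring.simps localization_def by blast
qed

section \<open>Functions and forms regular on X \<inter> Y with a finite pole order at
  infinity\<close>

definition meromorphic_funs :: "'f set" where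
  "meromorphic_funs =
     {g. regular_fun_on C affine_overlap g \<and> (\<exists>n. uniformizer ^ n * g \<in> local_ring C Infinity)}"

text \<open>The bound on the pole order is where the induction lowering it starts. Together with
  \<open>meromorphic_funs\<close> this is stable under sums, multiplication by functions and d,
  hence under every operation in the recursion for g.\<close>

definition meromorphic_forms :: "'w set" where
  "meromorphic_forms =
     {\<omega>. regular_form_on C affine_overlap \<omega> \<and> (\<exists>n. pole_order_le C n \<omega>)}"

lemma pole_bound_mono:
  assumes "uniformizer ^ m * g \<in> local_ring C Infinity" "m \<le> n"
  shows "uniformizer ^ n * g \<in> local_ring C Infinity"
proof -
  have "uniformizer ^ (n - m) * (uniformizer ^ m * g) \<in> local_ring C Infinity"
    using subalgebra_mult[OF subalgebra_infinity uniformizer_power_infinity assms(1)] .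
  also have "uniformizer ^ (n - m) * (uniformizer ^ m * g) = uniformizer ^ n * g"
    using assms(2) by (simp only: mult.assoc[symmetric] power_add[symmetric]) simp
  finally show ?thesis .
qed

lemma meromorphic_funs_cst: "cst C k \<in> meromorphic_funs"
proof -
  have "uniformizer ^ 0 * cst C k \<in> local_ring C Infinity"
    using subalgebra_cst[OF subalgebra_infinity] by simp
  then show ?thesis
    unfolding meromorphic_funs_def regular_fun_on_def
    using subalgebra_cst[OF subalgebra_overlap] by blast
qed

lemma meromorphic_funs_pole_fun: "pole_fun \<in> meromorphic_funs"
proof -
  have "uniformizer ^ 1 * pole_fun = 1" by simp
  then have "uniformizer ^ 1 * pole_fun \<in> local_ring C Infinity"
    using subalgebra_1[OF subalgebra_infinity] by (simp only:)
  then show ?thesis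
    unfolding meromorphic_funs_def regular_fun_on_def using pole_fun_overlap by blast
qed

lemma meromorphic_funs_mult:
  assumes "g \<in> meromorphic_funs" "h \<in> meromorphic_funs"
  shows "g * h \<in> meromorphic_funs"
proof -
  obtain m n where "uniformizer ^ m * g \<in> local_ring C Infinity" "uniformizer ^ n * h \<in> local_ring C Infinity"
    using assms unfolding meromorphic_funs_def by blast
  then have "uniformizer ^ m * g * (uniformizer ^ n * h) \<in> local_ring C Infinity"
    by (rule subalgebra_mult[OF subalgebra_infinity])
  also have "uniformizer ^ m * g * (uniformizer ^ n * h) = uniformizer ^ (m + n) * (g * h)"
    by (simp only: power_add mult_ac)
  finally show ?thesis
    using assms subalgebra_mult[OF subalgebra_overlap]
    unfolding meromorphic_funs_def regular_fun_on_def by blast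
qed

lemma meromorphic_funs_add:
  assumes "g \<in> meromorphic_funs" "h \<in> meromorphic_funs"
  shows "g + h \<in> meromorphic_funs"
proof -
  obtain m n where mn: "uniformizer ^ m * g \<in> local_ring C Infinity" "uniformizer ^ n * h \<in> local_ring C Infinity"
    using assms unfolding meromorphic_funs_def by blast
  have "uniformizer ^ (max m n) * g + uniformizer ^ (max m n) * h \<in> local_ring C Infinity"
    by (intro subalgebra_add[OF subalgebra_infinity] pole_bound_mono[OF mn(1)] pole_bound_mono[OF mn(2)]) simp_all
  then have "uniformizer ^ (max m n) * (g + h) \<in> local_ring C Infinity"
    by (simp only: distrib_left)
  then show ?thesis
    using assms subalgebra_add[OF subalgebra_overlap]
    unfolding meromorphic_funs_def regular_fun_on_def by blast
qed

lemma subalgebra_meromorphic_funs: "subalgebra meromorphic_funs"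
  unfolding subalgebra_def
  using meromorphic_funs_cst meromorphic_funs_add meromorphic_funs_mult by blast

lemma meromorphic_forms_zero: "0 \<in> meromorphic_forms"
  by (simp add: meromorphic_forms_def regular_form_on_def pole_order_le_def zero_local_forms)

lemma meromorphic_forms_add:
  "\<omega> \<in> meromorphic_forms \<Longrightarrow> \<eta> \<in> meromorphic_forms \<Longrightarrow> \<omega> + \<eta> \<in> meromorphic_forms"
  unfolding meromorphic_forms_def regular_form_on_def
  using local_forms_add pole_order_le_add by blast

lemma meromorphic_forms_smul:
  assumes "g \<in> meromorphic_funs" "\<omega> \<in> meromorphic_forms"
  shows "smul C g \<omega> \<in> meromorphic_forms"
proof -
  obtain m where m: "uniformizer ^ m * g \<in> local_ring C Infinity"
    using assms(1) unfolding meromorphic_funs_def by blast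
  obtain n where n: "pole_order_le C n \<omega>"
    using assms(2) unfolding meromorphic_forms_def by blast
  have "smul C (uniformizer ^ m * g) (smul C (uniformizer ^ n) \<omega>) \<in> local_forms C Infinity"
    by (rule local_forms_smul[OF subalgebra_infinity n[unfolded pole_order_le_def] m])
  also have "smul C (uniformizer ^ m * g) (smul C (uniformizer ^ n) \<omega>) =
      smul C (uniformizer ^ (m + n)) (smul C g \<omega>)"
    by (simp only: forms.scale_scale power_add mult_ac)
  finally have "pole_order_le C (m + n) (smul C g \<omega>)" by (simp only: pole_order_le_def)
  then show ?thesis
    using assms local_forms_smul[OF subalgebra_overlap]
    unfolding meromorphic_forms_def meromorphic_funs_def regular_form_on_def regular_fun_on_def by blast
qed

lemma meromorphic_forms_minus: "\<omega> \<in> meromorphic_forms \<Longrightarrow> - \<omega> \<in> meromorphic_forms"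
  using meromorphic_forms_smul[OF meromorphic_funs_cst[of "- 1"], of \<omega>] by (simp add: cst_minus)

lemma meromorphic_forms_sum:
  "(\<And>i. i \<in> I \<Longrightarrow> \<omega> i \<in> meromorphic_forms) \<Longrightarrow> sum \<omega> I \<in> meromorphic_forms"
  by (induction I rule: infinite_finite_induct) (auto intro: meromorphic_forms_zero meromorphic_forms_add)

text \<open>With h = t^(m+1) g regular at infinity, t dh = t^(m+2) dg + (m+1) h dt. The exponent m +
  1 instead of m puts the power into the form in which the power rule is stated.\<close>

lemma meromorphic_forms_dif:
  assumes "g \<in> meromorphic_funs"
  shows "dif C g \<in> meromorphic_forms"
proof -
  obtain m where "uniformizer ^ m * g \<in> local_ring C Infinity"
    using assms unfolding meromorphic_funs_def by blast
  define t where "t = uniformizer"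
  define h where "h = t ^ Suc m * g"
  have h: "h \<in> local_ring C Infinity" unfolding h_def t_def
    by (rule pole_bound_mono[OF \<open>uniformizer ^ m * g \<in> local_ring C Infinity\<close>]) simp
  have "dif C h = smul C (t ^ Suc m) (dif C g) + smul C g (dif C (t ^ Suc m))"
    unfolding h_def by (rule dif_mult)
  also have "dif C (t ^ Suc m) = smul C (of_nat (Suc m) * t ^ m) (dif C t)"
    by (rule dif_power)
  finally have "smul C t (dif C h) = smul C (t ^ Suc (Suc m)) (dif C g) + smul C (t * g * (of_nat (Suc m) * t ^ m)) (dif C t)"
    by (simp only: forms.scale_right_distrib forms.scale_scale power_Suc mult.assoc)
  also have "t * g * (of_nat (Suc m) * t ^ m) = cst C (of_nat (Suc m)) * h"
    by (simp only: h_def cst_of_nat power_Suc mult_ac)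
  finally have "smul C (t ^ Suc (Suc m)) (dif C g) = smul C t (dif C h) + - smul C (cst C (of_nat (Suc m)) * h) (dif C t)"
    by simp
  also have "\<dots> \<in> local_forms C Infinity"
    using h uniformizer_infinity unfolding t_def
    by (intro local_forms_add local_forms_minus local_forms_smul local_forms_dif subalgebra_infinity
        subalgebra_mult subalgebra_cst)
  finally have "pole_order_le C (Suc (Suc m)) (dif C g)" by (simp only: pole_order_le_def t_def)
  then show ?thesis
    using assms local_forms_dif[OF subalgebra_overlap]
    unfolding meromorphic_forms_def meromorphic_funs_def regular_form_on_def regular_fun_on_def by blast
qed

lemma log_form_on_overlap_iff:
  "log_form_on C (insert Infinity affine_overlap) \<omega> \<longleftrightarrow>
    regular_form_on C affine_overlap \<omega> \<and> pole_order_le C 1 \<omega>"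
  by (simp only: log_form_on_def overlap_Diff)

lemma exists_log_form:
  assumes "\<omega> \<in> meromorphic_forms"
  shows "\<exists>g\<in>meromorphic_funs. log_form_on C (insert Infinity affine_overlap) (dif C g + \<omega>)"
proof -
  obtain n where "pole_order_le C n \<omega>" using assms unfolding meromorphic_forms_def by blast
  then show ?thesis using assms
  proof (induction n arbitrary: \<omega> rule: less_induct)
    case (less n)
    show ?case
    proof (cases "n \<le> 1")
      case True
      then have "pole_order_le C 1 \<omega>" using less.prems(1) pole_order_le_mono by blast
      then have "log_form_on C (insert Infinity affine_overlap) (dif C 0 + \<omega>)"
        using less.prems(2) by (simp add: log_form_on_overlap_iff meromorphic_forms_def)
      then show ?thesis using subalgebra_0[OF subalgebra_meromorphic_funs] by blast
    next
      case False
      then obtain m where n: "n = Suc (Suc m)" by (cases n; cases "n - 1") auto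
      obtain k where k: "pole_order_le C (Suc m) (\<omega> - dif C (cst C k * pole_fun ^ Suc m))"
        using pole_order_reduction less.prems(1) unfolding n by blast
      define g where "g = - (cst C k * pole_fun ^ Suc m)"
      have g: "g \<in> meromorphic_funs"
        unfolding g_def using subalgebra_meromorphic_funs meromorphic_funs_pole_fun
        by (intro subalgebra_minus subalgebra_mult subalgebra_cst subalgebra_power)
      have "pole_order_le C (Suc m) (dif C g + \<omega>)"
        using k by (simp only: g_def dif_minus) (simp only: uminus_add_conv_diff)
      then obtain h where h: "h \<in> meromorphic_funs"
        "log_form_on C (insert Infinity affine_overlap) (dif C h + (dif C g + \<omega>))"
        using less.IH[of "Suc m" "dif C g + \<omega>"] meromorphic_forms_add[OF meromorphic_forms_dif[OF g] less.prems(2)]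
        by (auto simp: n)
      then have "log_form_on C (insert Infinity affine_overlap) (dif C (h + g) + \<omega>)"
        by (simp only: dif_add add.assoc)
      then show ?thesis using meromorphic_funs_add[OF h(1) g] by blast
    qed
  qed
qed

section \<open>The recursion for the coefficients of the gauge\<close>

definition gauge_series :: "(letter list \<Rightarrow> 'w) \<Rightarrow> (letter list \<Rightarrow> 'f) \<Rightarrow> letter list \<Rightarrow> 'w" where
  "gauge_series a g w = convolve (smul C) (inverse_series g) (\<lambda>v. dif C (g v)) w +
     convolve (\<lambda>\<omega> h. smul C h \<omega>) (convolve (smul C) (inverse_series g) a) g w"

definition gauge_remainder :: "(letter list \<Rightarrow> 'w) \<Rightarrow> (letter list \<Rightarrow> 'f) \<Rightarrow> letter list \<Rightarrow> 'w" where
  \<comment> \<open>the part of \<open>gauge_series a g w\<close> that only involves \<open>g\<close> on words shorter than \<open>w\<close>\<close>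
  "gauge_remainder a g w =
     (\<Sum>k\<in>{1..<length w}. smul C (inverse_series g (take k w)) (dif C (g (drop k w)))) +
     (\<Sum>k\<in>{1..length w}. smul C (g (drop k w))
        (\<Sum>j<k. smul C (inverse_series g (take j w)) (a (drop j (take k w)))))"

lemma gauge_series_Nil: "a [] = 0 \<Longrightarrow> g [] = 1 \<Longrightarrow> gauge_series a g [] = 0"
  by (simp add: gauge_series_def convolve_def)

text \<open>In g^(-1) dg the term k = 0 is the differential of \<open>g w\<close>, and the term k =
  |w| vanishes because \<open>g []\<close> is constant. In g^(-1) a g, both \<open>g w\<close> and
  the inverse at w could only be paired with \<open>a [] = 0\<close>. So w itself enters through
  \<open>dif C (g w)\<close> alone.\<close>

lemma gauge_series_eq:
  assumes "a [] = 0" "g [] = 1" "w \<noteq> []"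
  shows "gauge_series a g w = dif C (g w) + gauge_remainder a g w"
proof -
  have l: "1 \<le> length w" using assms(3) by (cases w) auto
  have "{..length w} = insert 0 (insert (length w) {1..<length w})" using l by auto
  then have "convolve (smul C) (inverse_series g) (\<lambda>v. dif C (g v)) w = dif C (g w) +
      (\<Sum>k\<in>{1..<length w}. smul C (inverse_series g (take k w)) (dif C (g (drop k w))))"
    using l assms by (simp add: convolve_def)
  moreover have "convolve (\<lambda>\<omega> h. smul C h \<omega>) (convolve (smul C) (inverse_series g) a) g w =
      (\<Sum>k\<in>{1..length w}. smul C (g (drop k w))
        (\<Sum>j<k. smul C (inverse_series g (take j w)) (a (drop j (take k w)))))"
  proof -
    have inner: "convolve (smul C) (inverse_series g) a (take k w) =
        (\<Sum>j<k. smul C (inverse_series g (take j w)) (a (drop j (take k w))))" if "k \<le> length w" for k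
    proof -
      have "convolve (smul C) (inverse_series g) a (take k w) =
          (\<Sum>j\<le>k. smul C (inverse_series g (take j w)) (a (drop j (take k w))))"
        unfolding convolve_def using that by (intro sum.cong) (auto simp: min_def)
      also have "\<dots> = (\<Sum>j<k. smul C (inverse_series g (take j w)) (a (drop j (take k w))))"
        using assms(1) by (simp add: lessThan_Suc_atMost[symmetric])
      finally show ?thesis .
    qed
    have "{..length w} = insert 0 {1..length w}" using l by auto
    then have "convolve (\<lambda>\<omega> h. smul C h \<omega>) (convolve (smul C) (inverse_series g) a) g w =
        smul C (g w) (convolve (smul C) (inverse_series g) a (take 0 w)) +
        (\<Sum>k\<in>{1..length w}. smul C (g (drop k w)) (convolve (smul C) (inverse_series g) a (take k w)))"
      by (simp add: convolve_def[of "\<lambda>\<omega> h. smul C h \<omega>"])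
    also have "convolve (smul C) (inverse_series g) a (take 0 w) = 0"
      by (subst inner) auto
    finally show ?thesis using inner by simp
  qed
  ultimately show ?thesis by (simp add: gauge_series_def gauge_remainder_def)
qed

text \<open>The locality that makes a choice of g by recursion on word length well defined.\<close>

lemma gauge_remainder_cong:
  assumes eq: "\<And>v. length v < length w \<Longrightarrow> g v = h v"
  shows "gauge_remainder a g w = gauge_remainder a h w"
proof (cases "w = []")
  case False
  have inv: "inverse_series g v = inverse_series h v" if "length v < length w" for v
  proof (rule inverse_series_cong[of "length w - 1"])
    show "g u = h u" if "length u \<le> length w - 1" for u
      using that False by (intro eq) (cases w, auto)
    show "length v \<le> length w - 1" using that by simp
  qed
  have "(\<Sum>j<k. smul C (inverse_series g (take j w)) (a (drop j (take k w)))) =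
      (\<Sum>j<k. smul C (inverse_series h (take j w)) (a (drop j (take k w))))" if "k \<le> length w" for k
    using that by (intro sum.cong) (auto simp: inv)
  then show ?thesis
    unfolding gauge_remainder_def using False
    by (intro arg_cong2[where f = "(+)"] sum.cong) (auto simp: inv eq)
qed (simp add: gauge_remainder_def)

lemma inverse_series_meromorphic:
  assumes "\<And>v. length v \<le> length w \<Longrightarrow> g v \<in> meromorphic_funs"
  shows "inverse_series g w \<in> meromorphic_funs"
  using assms
proof (induction w rule: length_induct)
  case (1 w)
  note F = subalgebra_meromorphic_funs
  have "(\<Sum>k\<in>I. inverse_series g (take k w) * g (drop k w)) \<in> meromorphic_funs"
    if "I \<subseteq> {..<length w}" for I
    using finite_subset[OF that finite_lessThan] that
  proof (induction I rule: finite_induct)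
    case (insert k I)
    then have "inverse_series g (take k w) * g (drop k w) \<in> meromorphic_funs"
      using 1 by (intro subalgebra_mult[OF F]) auto
    then show ?case using insert by (simp add: subalgebra_add[OF F])
  qed (simp add: subalgebra_0[OF F])
  then show ?case by (simp add: inverse_series.simps[of g w] subalgebra_1[OF F] subalgebra_minus[OF F])
qed

lemma gauge_remainder_meromorphic:
  assumes a: "\<And>v. a v \<in> meromorphic_forms"
    and g: "\<And>v. length v < length w \<Longrightarrow> g v \<in> meromorphic_funs"
  shows "gauge_remainder a g w \<in> meromorphic_forms"
proof (cases "w = []")
  case False
  have inv: "inverse_series g v \<in> meromorphic_funs" if "length v < length w" for v
    using that by (intro inverse_series_meromorphic g) auto
  show ?thesis
    unfolding gauge_remainder_def using False
    by (intro meromorphic_forms_add meromorphic_forms_sum meromorphic_forms_smul meromorphic_forms_dif a inv g) auto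
qed (simp add: gauge_remainder_def meromorphic_forms_zero)

text \<open>The choice runs through all words along their length, without reference to a level, so a
  single g is obtained for all n.\<close>

lemma exists_gauge_series:
  assumes a: "\<And>v. a v \<in> meromorphic_forms" and a_Nil: "a [] = 0"
  obtains g where "g [] = 1" "\<And>w. g w \<in> meromorphic_funs"
    "\<And>w. log_form_on C (insert Infinity affine_overlap) (gauge_series a g w)"
proof -
  let ?Y = "insert Infinity affine_overlap"
  \<comment> \<open>States that r is an admissible coefficient at w, given g on shorter words.
    Membership in \<open>meromorphic_funs\<close> is carried along because the next remainders have
    to be in \<open>meromorphic_forms\<close>.\<close>
  define Q where "Q g w r \<longleftrightarrow> r \<in> meromorphic_funs \<and>
    (if w = [] then r = 1 else log_form_on C ?Y (dif C r + gauge_remainder a g w))"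
    for g :: "letter list \<Rightarrow> 'f" and w r
  have "\<exists>g. \<forall>w. Q g w (g w)"
  proof (rule dependent_wf_choice[OF wf_measure[of length]])
    fix g h :: "letter list \<Rightarrow> 'f" and w r
    assume "\<And>v. (v, w) \<in> measure length \<Longrightarrow> g v = h v"
    then have "gauge_remainder a g w = gauge_remainder a h w"
      by (intro gauge_remainder_cong) simp
    then show "Q g w r = Q h w r" by (simp add: Q_def)
  next
    fix w and g :: "letter list \<Rightarrow> 'f"
    assume "\<And>v. (v, w) \<in> measure length \<Longrightarrow> Q g v (g v)"
    then have g: "g v \<in> meromorphic_funs" if "length v < length w" for v
      using that by (simp add: Q_def)
    show "\<exists>r. Q g w r"
    proof (cases "w = []")
      case True
      then show ?thesis using subalgebra_1[OF subalgebra_meromorphic_funs] by (auto simp: Q_def)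
    next
      case False
      have "gauge_remainder a g w \<in> meromorphic_forms"
        by (rule gauge_remainder_meromorphic) (rule a, rule g)
      from exists_log_form[OF this] False show ?thesis by (auto simp: Q_def)
    qed
  qed
  then obtain g where g: "\<And>w. Q g w (g w)" by blast
  have Nil: "g [] = 1" using g[of "[]"] by (simp add: Q_def)
  show thesis
  proof (rule that[of g])
    show "g [] = 1" by (rule Nil)
    show "g w \<in> meromorphic_funs" for w using g[of w] by (simp add: Q_def)
    show "log_form_on C ?Y (gauge_series a g w)" for w
    proof (cases "w = []")
      case True
      then show ?thesis
        by (simp add: gauge_series_Nil a_Nil Nil log_form_on_overlap_iff regular_form_on_def
            pole_order_le_def zero_local_forms)
    next
      case False
      then show ?thesis using g[of w] by (simp add: Q_def gauge_series_eq a_Nil Nil)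
    qed
  qed
qed

lemma gauge_transforms_left_mult_matrix:
  assumes "g [] = 1" "\<And>w. g w \<in> meromorphic_funs"
  shows "gauge_transforms C affine_overlap (left_mult_matrix n g) (left_mult_matrix n a)
    (left_mult_matrix n (gauge_series a g))"
proof -
  let ?N = "2 ^ (n + 1) - 1 :: nat"
  have regular: "\<forall>x\<in>elements_mat (left_mult_matrix n h). regular_fun_on C affine_overlap x"
    if "\<And>w. h w \<in> meromorphic_funs" for h
  proof
    fix x assume "x \<in> elements_mat (left_mult_matrix n h)"
    then have "x \<in> meromorphic_funs"
      using that by (rule elements_left_mult_matrix[OF _ subalgebra_0[OF subalgebra_meromorphic_funs]])
    then show "regular_fun_on C affine_overlap x" by (simp add: meromorphic_funs_def)
  qed
  have inv: "left_mult_matrix n (inverse_series g) * left_mult_matrix n g = 1\<^sub>m ?N"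
    unfolding left_mult_matrix_mult
    by (rule left_mult_matrix_one) (simp_all add: convolve_inverse_series assms)
  \<comment> \<open>For square matrices over a field a left inverse is two-sided.\<close>
  then have inv': "left_mult_matrix n g * left_mult_matrix n (inverse_series g) = 1\<^sub>m ?N"
    by (rule mat_mult_left_right_inverse[OF left_mult_matrix_carrier(1) left_mult_matrix_carrier(1)])
  have "left_mult_matrix n (gauge_series a g) = fun_form_mult C (left_mult_matrix n (inverse_series g)) (map_mat (dif C) (left_mult_matrix n g)) +
      form_fun_mult C (fun_form_mult C (left_mult_matrix n (inverse_series g)) (left_mult_matrix n a)) (left_mult_matrix n g)"
    by (simp add: map_left_mult_matrix fun_form_mult_left_mult_matrix form_fun_mult_left_mult_matrix
        left_mult_matrix_add gauge_series_def[abs_def])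
  then show ?thesis
    unfolding gauge_transforms_def inverts_mat_def
    using inv inv' regular[of g] regular[of "inverse_series g"] assms inverse_series_meromorphic
    by (intro conjI bexI[of _ "left_mult_matrix n (inverse_series g)"] left_mult_matrix_carrier_dim) simp_all
qed

end

theorem theorem3:
  fixes C :: "('k::field_char_0, 'f::field, 'w::ab_group_add) curve"
    and \<alpha>0 \<alpha>1 :: 'w
  assumes "elliptic_curve C"
    and "regular_form_on C (points C) \<alpha>0"
    and "regular_form_on C (affine_points C) \<alpha>1"
    and "pole_order_le C 2 \<alpha>1" and "\<not> pole_order_le C 1 \<alpha>1"
    and "de_rham_basis C \<alpha>0 \<alpha>1"
  shows "\<exists>Y. zariski_open C Y \<and> Infinity \<in> Y \<and>
    (\<exists>(G :: nat \<Rightarrow> 'f mat) (C' :: nat \<Rightarrow> 'w mat).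
      G 0 = 1\<^sub>m 1 \<and>
      (\<forall>n. gauge_transforms C (Y \<inter> affine_points C) (G n)
              (connection_matrix n (nabla C \<alpha>0 \<alpha>1 n)) (C' n) \<and>
           C' n \<in> carrier_mat (2 ^ (n + 1) - 1) (2 ^ (n + 1) - 1) \<and>
           (\<forall>\<omega>\<in>elements_mat (C' n). log_form_on C Y \<omega>)) \<and>
      (\<forall>n\<ge>1.
        projection_matrix (n - 1) * G n = G (n - 1) * projection_matrix (n - 1) \<and>
        fun_form_mult C (projection_matrix (n - 1)) (C' n) =
          form_fun_mult C (C' (n - 1)) (projection_matrix (n - 1)) \<and>
        (\<exists>H \<in> carrier_mat (2 ^ n) (2 ^ n - 1).
          G n = four_block_mat (1\<^sub>m (2 ^ n)) H (0\<^sub>m (2 ^ n - 1) (2 ^ n)) (G (n - 1)) \<and>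
          (\<forall>i<n. \<forall>r\<in>{1..2 ^ (n - i)}. \<exists>h. H_block n H r i = h \<cdot>\<^sub>m 1\<^sub>m (2 ^ i))) \<and>
        (\<forall>i\<le>n.
          (\<forall>r\<in>{1..2 ^ (n + 1 - i) - 2}. \<exists>c. log_form_on C Y c \<and>
              C_block n (C' n) r i = scalar_form_mat (2 ^ i) c) \<and>
          C_block n (C' n) (2 ^ (n + 1 - i) - 1) i = 0\<^sub>m (2 ^ i) (2 ^ i) \<and>
          C_block n (C' n) (2 ^ (n + 1 - i)) i = 0\<^sub>m (2 ^ i - 1) (2 ^ i))))"
proof -
  interpret elliptic C by (rule elliptic.intro) (rule assms(1))
  \<comment> \<open>The pole of \<alpha>1 of exact order 2 guarantees that the ideal of infinity is
    proper.\<close>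
  interpret elliptic_infinity C
    by unfold_locales (rule infinity_ideal_proper_if_nonlogarithmic[OF assms(4,5)])
  let ?Y = "insert Infinity affine_overlap" and ?a = "connection_series \<alpha>0 \<alpha>1"
  have "\<alpha>0 \<in> meromorphic_forms"
  proof -
    have "pole_order_le C 0 \<alpha>0" using assms(2)
      by (simp add: pole_order_le_def regular_form_on_def points_def)
    then show ?thesis using assms(2) affine_overlap_subset
      unfolding meromorphic_forms_def regular_form_on_def points_def by blast
  qed
  moreover have "\<alpha>1 \<in> meromorphic_forms"
    using assms(3,4) affine_overlap_subset unfolding meromorphic_forms_def regular_form_on_def by blast
  ultimately have "?a w \<in> meromorphic_forms" for w
    by (simp add: connection_series_def meromorphic_forms_minus meromorphic_forms_zero)
  moreover have a_Nil: "?a [] = 0" by (simp add: connection_series_def)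
  ultimately obtain g where g: "g [] = 1" "\<And>w. g w \<in> meromorphic_funs"
    "\<And>w. log_form_on C ?Y (gauge_series ?a g w)"
    by (rule exists_gauge_series) blast
  define c where "c = gauge_series ?a g"
  \<comment> \<open>The source of the zero block in (B2), whose prefix is the empty word.\<close>
  have c_Nil: "c [] = 0" using gauge_series_Nil[of ?a g] a_Nil g(1) by (simp add: c_def)
  define G where "G n = left_mult_matrix n g" for n
  define C' where "C' n = left_mult_matrix n c" for n
  have G0: "G 0 = 1\<^sub>m 1"
    by (rule eq_matI) (simp_all add: G_def index_left_mult_matrix g(1))
  have gauge: "gauge_transforms C (?Y \<inter> affine_points C) (G n)
      (connection_matrix n (nabla C \<alpha>0 \<alpha>1 n)) (C' n)" for n
    unfolding overlap_Int G_def C'_def c_def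
    using gauge_transforms_left_mult_matrix[of g n ?a] g(1,2) by (simp add: connection_matrix_nabla)
  have log_0: "log_form_on C ?Y 0" using g(3)[of "[]"] c_Nil by (simp add: c_def)
  have elements: "\<forall>\<omega>\<in>elements_mat (C' n). log_form_on C ?Y \<omega>" for n
  proof
    fix \<omega> assume "\<omega> \<in> elements_mat (C' n)"
    then have "\<omega> \<in> {\<omega>. log_form_on C ?Y \<omega>}" unfolding C'_def
      by (rule elements_left_mult_matrix) (use log_0 g(3) in \<open>simp_all add: c_def\<close>)
    then show "log_form_on C ?Y \<omega>" by simp
  qed
  have H: "\<exists>H \<in> carrier_mat (2 ^ n) (2 ^ n - 1).
      G n = four_block_mat (1\<^sub>m (2 ^ n)) H (0\<^sub>m (2 ^ n - 1) (2 ^ n)) (G (n - 1)) \<and>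
      (\<forall>i<n. \<forall>r\<in>{1..2 ^ (n - i)}. \<exists>h. H_block n H r i = h \<cdot>\<^sub>m 1\<^sub>m (2 ^ i))" if n: "1 \<le> n" for n
  proof -
    obtain H where "H \<in> carrier_mat (2 ^ n) (2 ^ n - 1)"
      "left_mult_matrix n g =
        four_block_mat (1\<^sub>m (2 ^ n)) H (0\<^sub>m (2 ^ n - 1) (2 ^ n)) (left_mult_matrix (n - 1) g)"
      "\<And>i r. i < n \<Longrightarrow> r \<in> {1..2 ^ (n - i)} \<Longrightarrow>
        H_block n H r i = g (words (n - i) ! (r - 1)) \<cdot>\<^sub>m 1\<^sub>m (2 ^ i)"
      using left_mult_matrix_four_block[of n g, OF n g(1)] by metis
    then show ?thesis unfolding G_def by blast
  qed
  have B: "\<forall>r\<in>{1..2 ^ (n + 1 - i) - 2}. \<exists>c. log_form_on C ?Y c \<and>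
          C_block n (C' n) r i = scalar_form_mat (2 ^ i) c"
    "C_block n (C' n) (2 ^ (n + 1 - i) - 1) i = 0\<^sub>m (2 ^ i) (2 ^ i)"
    "C_block n (C' n) (2 ^ (n + 1 - i)) i = 0\<^sub>m (2 ^ i - 1) (2 ^ i)" if i: "i \<le> n" for n i
  proof -
    show "\<forall>r\<in>{1..2 ^ (n + 1 - i) - 2}. \<exists>c. log_form_on C ?Y c \<and>
          C_block n (C' n) r i = scalar_form_mat (2 ^ i) c"
    proof
      fix r :: nat assume "r \<in> {1..2 ^ (n + 1 - i) - 2}"
      then have "1 \<le> r" "r \<le> 2 ^ (n + 1 - i) - 1" by auto
      from C_block_left_mult_matrix[OF i this, of c]
      show "\<exists>c. log_form_on C ?Y c \<and> C_block n (C' n) r i = scalar_form_mat (2 ^ i) c"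
        unfolding C'_def c_def using g(3) by blast
    qed
  next
    have ni: "n + 1 - i = n - i + 1" using i by simp
    have "1 \<le> (2::nat) ^ (n - i)" by simp
    then have le: "1 \<le> 2 ^ (n + 1 - i) - (1::nat)"
      unfolding ni power_add power_one_right by linarith
    \<comment> \<open>Blocks are counted from 1 and list positions from 0: the last full block
      belongs to the last word of length at most n - i, the empty one.\<close>
    have "2 ^ (n + 1 - i) - 1 - 1 = 2 ^ (n - i + 1) - (2::nat)" using i by (simp add: Suc_diff_le)
    then have "word_basis (n - i) ! (2 ^ (n + 1 - i) - 1 - 1) = []"
      using last_word_basis[of "n - i"] by (simp only:)
    then show "C_block n (C' n) (2 ^ (n + 1 - i) - 1) i = 0\<^sub>m (2 ^ i) (2 ^ i)"
      using C_block_left_mult_matrix[OF i le order_refl, of c]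
      by (auto simp: C'_def c_Nil scalar_form_mat_def)
  next
    show "C_block n (C' n) (2 ^ (n + 1 - i)) i = 0\<^sub>m (2 ^ i - 1) (2 ^ i)"
      unfolding C'_def by (rule C_block_left_mult_matrix_last[OF i])
  qed
  have P: "projection_matrix (n - 1) * G n = G (n - 1) * projection_matrix (n - 1)"
    "fun_form_mult C (projection_matrix (n - 1)) (C' n) =
      form_fun_mult C (C' (n - 1)) (projection_matrix (n - 1))" if "1 \<le> n" for n
    unfolding G_def C'_def
    by (rule projection_matrix_mult[OF that], rule projection_matrix_form_mult[OF that], simp_all)
  have carrier: "C' n \<in> carrier_mat (2 ^ (n + 1) - 1) (2 ^ (n + 1) - 1)" for n
    unfolding C'_def by (rule left_mult_matrix_carrier)
  show ?thesis
    by (intro exI[of _ ?Y] conjI zariski_open_overlap insertI1 exI[of _ G] exI[of _ C'] allI impI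
        G0 gauge carrier elements P H B)
qed

end
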